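(* Let $e\ge0$, $n\ge1$, $(n,e)\ne(1,0)$, $d,m\ge2$, let $P(X,S)=S^d+f_{d-1}(X)S^{d-1}+\cdots+f_0(X)$ and $Q(X,Y)=Y^m+g_{m-1}(X)Y^{m-1}+\cdots+g_0(X)$ with $f_i,g_j\in k[X]$, and let $$R=R_{n,e,P,Q}=k[X,Y,Z]/\langle X^nY-P(X,Q(X,Y)-X^eZ)\rangle,\qquad B_{n,P}=k[X,S,Y]/\langle X^nY-P(X,S)\rangle .$$ Put $$F(X,S)=P(X,S)^m+X^ng_{m-1}(X)P(X,S)^{m-1}+\cdots+X^{n(m-1)}g_1(X)P(X,S)+X^{nm}g_0(X)-X^{nm}S,$$ and let $I_1=\langle X^{nm+e},X^{n(m-1)+e}P(X,S),F(X,S)\rangle\subset k[X,S]$, $I_2=\langle X^n,P(X,S)\rangle\subset k[X,S]$ and $I_3=\langle X^e,Q(X,Y)-S\rangle\subset B_{n,P}$. With the $\mathrm{AL}$-invariant $\mathrm{AL}(R)=k[x,s]$ identified with the polynomial ring $k[X,S]$, where $x,y,z$ are the classes of $X,Y,Z$ in $R$ and $s=Q(x,y)-x^ez$: (1) $R_{n,e,P,Q}$ is the affine modification of the $\mathrm{AL}$-invariant $k[X,S]$ along $X^{nm+e}$ with center $I_1$. (2) $B_{n,P}$ is the affine modification of the $\mathrm{AL}$-invariant $k[X,S]$ along $X^n$ with center $I_2$. (3) $R_{n,e,P,Q}$ is the affine modification of $B_{n,P}$ along $X^e$ with center $I_3$.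
   Context: $k$ is a field of characteristic zero. For a $k$-domain $B$, the $\mathrm{AL}$-invariant $\mathrm{AL}(B)$ is the subalgebra generated by $\ker\partial^2$ for all non-zero locally nilpotent $k$-derivations $\partial$ of $B$. For a domain $A$, an ideal $I\subset A$ and a non-zero $f\in I$, the affine modification of $A$ along $f$ with center $I$ is the subalgebra $A[I/f]$ of the fraction field of $A$ generated by $A$ and all $a/f$, $a\in I$. Saying that an algebra is an affine modification of $A$ means that it is $k$-isomorphic to it, compatibly with the embedding of $A$ (here $X\mapsto x$, $S\mapsto s$; and $B_{n,P}$ embeds in $R_{n,e,P,Q}$ by sending $X,S,Y$ to $x,s,y$). *)

theory Defs
  imports "HOL-Algebra.Algebra" "HOL-Algebra.Algebraic_Closure_Type"
begin

text \<open>
  A $k$-algebra is a ring \<open>B\<close> in the sense of HOL-Algebra together with its structure map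
  \<open>\<iota> :: 'k \<Rightarrow> 'b\<close>, whose image is the copy of the ground field inside \<open>B\<close>.
\<close>

definition alg_hom ::
  "('k \<Rightarrow> 'a) \<Rightarrow> 'a ring \<Rightarrow> ('k \<Rightarrow> 'b) \<Rightarrow> 'b ring \<Rightarrow> ('a \<Rightarrow> 'b) \<Rightarrow> bool" where
  "alg_hom \<iota> A \<kappa> B \<phi> \<longleftrightarrow> \<phi> \<in> ring_hom A B \<and> (\<forall>c. \<phi> (\<iota> c) = \<kappa> c)"

definition subalg_gen :: "('k \<Rightarrow> 'b) \<Rightarrow> 'b ring \<Rightarrow> 'b set \<Rightarrow> 'b set" where
  "subalg_gen \<iota> B H = generate_ring B (range \<iota> \<union> H)"


section \<open>Locally nilpotent derivations and the AL-invariant\<close>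

text \<open>Derivations are only constrained, and only looked at, on the carrier.\<close>

definition k_derivation :: "('k \<Rightarrow> 'b) \<Rightarrow> 'b ring \<Rightarrow> ('b \<Rightarrow> 'b) \<Rightarrow> bool" where
  "k_derivation \<iota> B D \<longleftrightarrow>
     D \<in> carrier B \<rightarrow> carrier B \<and>
     (\<forall>a\<in>carrier B. \<forall>b\<in>carrier B. D (a \<oplus>\<^bsub>B\<^esub> b) = D a \<oplus>\<^bsub>B\<^esub> D b) \<and>
     (\<forall>a\<in>carrier B. \<forall>b\<in>carrier B. D (a \<otimes>\<^bsub>B\<^esub> b) = (D a \<otimes>\<^bsub>B\<^esub> b) \<oplus>\<^bsub>B\<^esub> (a \<otimes>\<^bsub>B\<^esub> D b)) \<and>
     (\<forall>c. D (\<iota> c) = \<zero>\<^bsub>B\<^esub>)"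

definition locally_nilpotent :: "'b ring \<Rightarrow> ('b \<Rightarrow> 'b) \<Rightarrow> bool" where
  "locally_nilpotent B D \<longleftrightarrow> (\<forall>b\<in>carrier B. \<exists>N. (D ^^ N) b = \<zero>\<^bsub>B\<^esub>)"

definition nonzero_LND :: "('k \<Rightarrow> 'b) \<Rightarrow> 'b ring \<Rightarrow> ('b \<Rightarrow> 'b) \<Rightarrow> bool" where
  "nonzero_LND \<iota> B D \<longleftrightarrow>
     k_derivation \<iota> B D \<and> locally_nilpotent B D \<and> (\<exists>b\<in>carrier B. D b \<noteq> \<zero>\<^bsub>B\<^esub>)"

definition AL_invariant :: "('k \<Rightarrow> 'b) \<Rightarrow> 'b ring \<Rightarrow> 'b set" where
  "AL_invariant \<iota> B =
     subalg_gen \<iota> B (\<Union>D\<in>{D. nonzero_LND \<iota> B D}. {b \<in> carrier B. D (D b) = \<zero>\<^bsub>B\<^esub>})"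


section \<open>Fraction fields and affine modifications\<close>

definition frac_rel :: "'a ring \<Rightarrow> (('a \<times> 'a) \<times> ('a \<times> 'a)) set" where
  "frac_rel A = {((a, b), (c, d)).
     a \<in> carrier A \<and> b \<in> carrier A - {\<zero>\<^bsub>A\<^esub>} \<and> c \<in> carrier A \<and> d \<in> carrier A - {\<zero>\<^bsub>A\<^esub>} \<and>
     a \<otimes>\<^bsub>A\<^esub> d = c \<otimes>\<^bsub>A\<^esub> b}"

definition frac :: "'a ring \<Rightarrow> 'a \<Rightarrow> 'a \<Rightarrow> ('a \<times> 'a) set" where
  "frac A a b = frac_rel A `` {(a, b)}"

definition frac_field :: "'a ring \<Rightarrow> ('a \<times> 'a) set ring" where
  "frac_field A = \<lparr>
     carrier = (carrier A \<times> (carrier A - {\<zero>\<^bsub>A\<^esub>})) // frac_rel A,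
     monoid.mult = (\<lambda>U V. \<Union>(a, b)\<in>U. \<Union>(c, d)\<in>V. frac A (a \<otimes>\<^bsub>A\<^esub> c) (b \<otimes>\<^bsub>A\<^esub> d)),
     one = frac A \<one>\<^bsub>A\<^esub> \<one>\<^bsub>A\<^esub>,
     ring.zero = frac A \<zero>\<^bsub>A\<^esub> \<one>\<^bsub>A\<^esub>,
     add = (\<lambda>U V. \<Union>(a, b)\<in>U. \<Union>(c, d)\<in>V.
              frac A ((a \<otimes>\<^bsub>A\<^esub> d) \<oplus>\<^bsub>A\<^esub> (c \<otimes>\<^bsub>A\<^esub> b)) (b \<otimes>\<^bsub>A\<^esub> d)) \<rparr>"

definition affine_modification :: "'a ring \<Rightarrow> 'a set \<Rightarrow> 'a \<Rightarrow> ('a \<times> 'a) set ring" where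
  "affine_modification A I f = (frac_field A) \<lparr> carrier :=
     generate_ring (frac_field A)
       ({frac A a \<one>\<^bsub>A\<^esub> | a. a \<in> carrier A} \<union> {frac A a f | a. a \<in> I}) \<rparr>"

text \<open>
  \<open>R\<close> is the affine modification of \<open>A\<close> along \<open>f\<close> with center \<open>I\<close>, where \<open>A\<close> is regarded as a
  subalgebra of \<open>R\<close> by means of \<open>\<phi>\<close>. If \<open>\<phi>\<close> is a homomorphism of $k$-algebras, the isomorphism
  required here is automatically one of $k$-algebras, because it extends \<open>\<phi>\<close>; and \<open>\<phi>\<close> is
  automatically injective.
\<close>

definition is_affine_modification ::
  "('a \<Rightarrow> 'r) \<Rightarrow> 'r ring \<Rightarrow> 'a ring \<Rightarrow> 'a \<Rightarrow> 'a set \<Rightarrow> bool" where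
  "is_affine_modification \<phi> R A f I \<longleftrightarrow>
     domain A \<and> ideal I A \<and> f \<in> I \<and> f \<noteq> \<zero>\<^bsub>A\<^esub> \<and>
     (\<exists>\<psi>\<in>ring_iso (affine_modification A I f) R.
        \<forall>a\<in>carrier A. \<psi> (frac A a \<one>\<^bsub>A\<^esub>) = \<phi> a)"


section \<open>Polynomial rings in two and three variables\<close>

text \<open>
  $k[X,S]$ is rendered as $k[X][S]$, and a polynomial ring $k[T_1,T_2,T_3]$ as
  $k[T_1][T_2][T_3]$; so the first variable is the innermost one. The variables
  \<open>T1\<close>, \<open>T2\<close>, \<open>T3\<close> stand for $X,Y,Z$ in the definition of $R$ and for $X,S,Y$ in that of $B$.
\<close>

type_synonym 'k poly2 = "'k poly poly"
type_synonym 'k poly3 = "'k poly poly poly"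

abbreviation poly2_ring :: "'k::field_char_0 poly2 ring" where
  "poly2_ring \<equiv> ring_of_type_algebra"

abbreviation poly3_ring :: "'k::field_char_0 poly3 ring" where
  "poly3_ring \<equiv> ring_of_type_algebra"

definition X2 :: "'k::field_char_0 poly2" where "X2 = [:[:0, 1:]:]"
definition S2 :: "'k::field_char_0 poly2" where "S2 = [:0, 1:]"

definition T1 :: "'k::field_char_0 poly3" where "T1 = [:[:[:0, 1:]:]:]"
definition T2 :: "'k::field_char_0 poly3" where "T2 = [:[:0, 1:]:]"
definition T3 :: "'k::field_char_0 poly3" where "T3 = [:0, 1:]"

definition const2 :: "'k::field_char_0 \<Rightarrow> 'k poly2" where "const2 c = [:[:c:]:]"
definition const3 :: "'k::field_char_0 \<Rightarrow> 'k poly3" where "const3 c = [:[:[:c:]:]:]"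

text \<open>The inclusions of $k[X]$.\<close>

definition inX2 :: "'k::field_char_0 poly \<Rightarrow> 'k poly2" where "inX2 p = [:p:]"
definition inX3 :: "'k::field_char_0 poly \<Rightarrow> 'k poly3" where "inX3 p = [:[:p:]:]"

text \<open>
  The value at \<open>t\<close> of the monic polynomial $T^d + c_{d-1}T^{d-1} + \cdots + c_0$, with coefficients
  mapped by \<open>j\<close>. So $P(X,t)$ is \<open>monic_at j f d t\<close> and $Q(X,t)$ is \<open>monic_at j g m t\<close>, where \<open>j\<close> is
  \<open>inX2\<close> or \<open>inX3\<close>. Only the coefficients with index less than \<open>d\<close> matter.
\<close>

definition monic_at :: "('a \<Rightarrow> 'b::comm_ring_1) \<Rightarrow> (nat \<Rightarrow> 'a) \<Rightarrow> nat \<Rightarrow> 'b \<Rightarrow> 'b" where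
  "monic_at j c d t = t ^ d + (\<Sum>i<d. j (c i) * t ^ i)"


section \<open>The algebras \<open>R\<close> and \<open>B\<close>\<close>

context
  fixes n e d m :: nat and f g :: "nat \<Rightarrow> 'k::field_char_0 poly"
begin

text \<open>The polynomial $Q(X,Y) - X^eZ$, whose class is $s$.\<close>

definition sR_poly :: "'k poly3" where
  "sR_poly = monic_at inX3 g m T2 - T1 ^ e * T3"

definition R_ideal :: "'k poly3 set" where
  "R_ideal = PIdl\<^bsub>poly3_ring\<^esub> (T1 ^ n * T2 - monic_at inX3 f d sR_poly)"

definition R_alg :: "'k poly3 set ring" where
  "R_alg = poly3_ring Quot R_ideal"

definition R_class :: "'k poly3 \<Rightarrow> 'k poly3 set" where
  "R_class p = R_ideal +>\<^bsub>poly3_ring\<^esub> p"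

definition B_ideal :: "'k poly3 set" where
  "B_ideal = PIdl\<^bsub>poly3_ring\<^esub> (T1 ^ n * T3 - monic_at inX3 f d T2)"

definition B_alg :: "'k poly3 set ring" where
  "B_alg = poly3_ring Quot B_ideal"

definition B_class :: "'k poly3 \<Rightarrow> 'k poly3 set" where
  "B_class p = B_ideal +>\<^bsub>poly3_ring\<^esub> p"

definition P_poly :: "'k poly2" where
  "P_poly = monic_at inX2 f d S2"

definition F_poly :: "'k poly2" where
  "F_poly = P_poly ^ m + (\<Sum>j<m. X2 ^ (n * (m - j)) * inX2 (g j) * P_poly ^ j) - X2 ^ (n * m) * S2"

definition I1 :: "'k poly2 set" where
  "I1 = Idl\<^bsub>poly2_ring\<^esub> {X2 ^ (n * m + e), X2 ^ (n * (m - 1) + e) * P_poly, F_poly}"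

definition I2 :: "'k poly2 set" where
  "I2 = Idl\<^bsub>poly2_ring\<^esub> {X2 ^ n, P_poly}"

definition I3 :: "'k poly3 set set" where
  "I3 = Idl\<^bsub>B_alg\<^esub> {B_class (T1 ^ e), B_class (monic_at inX3 g m T3 - T2)}"

end

end

theory Submission
  imports Defs "HOL-Computational_Algebra.Formal_Laurent_Series"
    "HOL-Computational_Algebra.Polynomial_FPS"
begin

text \<open>
  All algebras in question lie in $L = k((x))[s]$. Put $y = P(x,s)/x^n$ and
  $z = (Q(x,y) - s)/x^e$ in $L$. The evaluations $X, Y, Z \mapsto x, y, z$ and
  $X, S, Y \mapsto x, s, y$ kill the defining relations of \<open>R\<close> and \<open>B\<close>, and the point is that
  they kill nothing else. Modulo the relation of \<open>R\<close> every polynomial is a $k[X]$-combination of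
  the monomials $s^i y^j z^l$ with $i < d$ and $j < m$. In $L$ such a monomial has degree
  $i + dj + dml$ in $s$, and each natural number has exactly one such expansion. So the images are
  linearly independent over $k[X]$ (\<open>kernel_R\<close>, \<open>kernel_B\<close>), and the leading coefficient of an
  element of \<open>R\<close> of degree $q = i + dj + dml$ in $s$ is a polynomial in $x$ divided by $x$ to the
  power $nj + (nm+e)l$ (\<open>lead_coeff_R\<close>).

  The statements about affine modifications then become computations in $L$: the ring $A[I/f]$ is
  generated by $A$ and the $a/f$ for generators $a$ of $I$ (\<open>is_affine_modificationI\<close>). The quotients of
  the given generators are $1, y, z$ for $I_1$, because $F = x^{nm}(Q(x,y) - s) = x^{nm+e} z$;
  they are $1, y$ for $I_2$ and $1, z$ for $I_3$.

  It remains to find the AL-invariant of \<open>R\<close>. A derivation $D$ of \<open>R\<close> is the restriction of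
  $u\,\partial_x + v\,\partial_s$ with $u = Dx$ and $v = Ds$ (\<open>D_eq_E\<close>). The leading term of an element
  of $L$ is taken here with respect to the highest power of $s$ first and the lowest power of $x$
  second. On leading exponents $(q,a)$, standing for $x^a s^q$, such a $D$ acts by a fixed shift
  $(\delta,p)$ and multiplies the coefficient by a linear form $\alpha a + \beta q$. If $D$ is
  locally nilpotent, then iterating $D$ must hit a zero of this form, starting at the leading
  exponent of any non-zero element of \<open>R\<close>. After rescaling, $x, s, y, z$ therefore have weights
  $A, B, H, Z$ in $\mathbb{N}$, and the shift has weight $-1$. If $A > 0$, then $Dx$, $Ds$ and, for
  $H > 0$, $Dy$ have weights $A-1$, $B-1$ and $H-1$. But by the shape of the leading coefficients an
  element of degree $q$ in $s$ has weight at least $B (q \bmod d)$ (\<open>weight_bound\<close>). This gives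
  $\delta \equiv -1 \pmod d$ and makes $A$ and $H$ so large compared with $B$ that $dB = H + nA$
  fails (\<open>weights_inconsistent\<close>). Hence $A = 0$, and then $B = 1$ and $\delta = -1$, that is, $Dx = 0$
  and $D = v\,\partial_s$ with $v \in k((x))$.

  The kernel of $D^2$ thus consists of the elements of degree at most $1$ in $s$, and these form
  $k[x] + k[x]s$ because $d \ge 2$ (\<open>degree_le_1_R\<close>). Conversely, $x$ and $s$ are killed by the square of
  $x^{nm+e}\partial_s$, which maps \<open>R\<close> to itself. So $\mathrm{AL}(R) = k[x,s]$ (\<open>AL_R\<close>).
\<close>

section \<open>Ring homomorphisms and evaluation of polynomials\<close>

locale comm_ring_map =
  fixes h :: "'a::comm_ring_1 \<Rightarrow> 'b::comm_ring_1"
  assumes map_one: "h 1 = 1"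
    and map_add: "h (a + b) = h a + h b"
    and map_mult: "h (a * b) = h a * h b"
begin

lemma map_zero: "h 0 = 0"
  using map_add[of 0 0] by simp

lemma map_uminus: "h (- a) = - h a"
  using map_add[of a "- a"] map_zero by (simp add: eq_neg_iff_add_eq_0 add.commute)

lemma map_diff: "h (a - b) = h a - h b"
  using map_add[of a "- b"] by (simp add: map_uminus)

lemma map_power: "h (a ^ k) = h a ^ k"
  by (induction k) (simp_all add: map_one map_mult)

lemma map_sum: "h (sum c I) = (\<Sum>i\<in>I. h (c i))"
  by (induction I rule: infinite_finite_induct) (simp_all add: map_zero map_add)

lemma map_monic_at: "h (monic_at j c k t) = monic_at (\<lambda>a. h (j a)) c k (h t)"
  by (simp add: monic_at_def map_add map_power map_sum map_mult)

lemmas map_simps = map_one map_zero map_add map_uminus map_diff map_mult map_power map_sum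
  map_monic_at

end

definition eval_at :: "('a::comm_ring_1 \<Rightarrow> 'b::comm_ring_1) \<Rightarrow> 'b \<Rightarrow> 'a poly \<Rightarrow> 'b" where
  "eval_at h t p = poly (map_poly h p) t"

lemma (in comm_ring_map) eval_at_pCons: "eval_at h t (pCons a p) = h a + t * eval_at h t p"
  by (simp add: eval_at_def map_poly_pCons map_zero)

lemma (in comm_ring_map) eval_at_0: "eval_at h t 0 = 0"
  by (simp add: eval_at_def)

lemma (in comm_ring_map) eval_at_const: "eval_at h t [:a:] = h a"
  by (simp add: eval_at_pCons eval_at_0)

lemma (in comm_ring_map) eval_at_var: "eval_at h t [:0, 1:] = t"
  by (simp add: eval_at_pCons eval_at_0 map_zero map_one)

lemma (in comm_ring_map) eval_at_add: "eval_at h t (p + q) = eval_at h t p + eval_at h t q"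
  by (induction p q rule: poly_induct2) (simp_all add: eval_at_pCons eval_at_0 map_add algebra_simps)

lemma (in comm_ring_map) eval_at_smult: "eval_at h t (smult a p) = h a * eval_at h t p"
  by (induction p) (simp_all add: eval_at_pCons eval_at_0 map_mult algebra_simps)

lemma (in comm_ring_map) comm_ring_map_eval_at: "comm_ring_map (eval_at h t)"
proof
  show "eval_at h t 1 = 1"
    using eval_at_const[of t 1] by (simp add: map_one one_pCons)
  show "eval_at h t (p + q) = eval_at h t p + eval_at h t q" for p q
    by (rule eval_at_add)
  show "eval_at h t (p * q) = eval_at h t p * eval_at h t q" for p q
    by (induction p)
       (simp_all add: eval_at_pCons eval_at_0 eval_at_add eval_at_smult map_zero algebra_simps)
qed

lemma poly_ring_induct [consumes 0, case_names const var add mult]: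
  fixes p :: "'a::comm_ring_1 poly"
  assumes "\<And>a. Q [:a:]" "Q [:0, 1:]" "\<And>p q. Q p \<Longrightarrow> Q q \<Longrightarrow> Q (p + q)"
    "\<And>p q. Q p \<Longrightarrow> Q q \<Longrightarrow> Q (p * q)"
  shows "Q p"
proof (induction p)
  case 0
  show ?case using assms(1)[of 0] by simp
next
  case (pCons a p)
  have "pCons a p = [:a:] + [:0, 1:] * p" by simp
  then show ?case using assms(3)[OF assms(1) assms(4)[OF assms(2) pCons.IH]] by metis
qed

lemma poly2_induct [case_names const X S add mult]:
  fixes p :: "'k::field_char_0 poly2"
  assumes "\<And>c. Q (const2 c)" "Q X2" "Q S2" "\<And>p q. Q p \<Longrightarrow> Q q \<Longrightarrow> Q (p + q)"
    "\<And>p q. Q p \<Longrightarrow> Q q \<Longrightarrow> Q (p * q)"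
  shows "Q p"
proof (induction p rule: poly_ring_induct)
  case (const a)
  show ?case
  proof (induction a rule: poly_ring_induct)
    case (add p q)
    then show ?case using assms(4)[of "[:p:]" "[:q:]"] by simp
  next
    case (mult p q)
    then show ?case using assms(5)[of "[:p:]" "[:q:]"] by (simp add: mult.commute)
  qed (use assms(1,2) in \<open>auto simp: const2_def X2_def\<close>)
qed (use assms in \<open>auto simp: S2_def\<close>)

lemma poly3_induct [case_names const T1 T2 T3 add mult]:
  fixes p :: "'k::field_char_0 poly3"
  assumes "\<And>c. Q (const3 c)" "Q T1" "Q T2" "Q T3" "\<And>p q. Q p \<Longrightarrow> Q q \<Longrightarrow> Q (p + q)"
    "\<And>p q. Q p \<Longrightarrow> Q q \<Longrightarrow> Q (p * q)"
  shows "Q p"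
proof (induction p rule: poly_ring_induct)
  case (const a)
  show ?case
  proof (induction a rule: poly2_induct)
    case (add p q)
    then show ?case using assms(5)[of "[:p:]" "[:q:]"] by simp
  next
    case (mult p q)
    then show ?case using assms(6)[of "[:p:]" "[:q:]"] by (simp add: mult.commute)
  qed (use assms(1,2,3) in \<open>auto simp: const2_def X2_def S2_def const3_def T1_def T2_def\<close>)
qed (use assms in \<open>auto simp: T3_def\<close>)

section \<open>The ambient ring of polynomials in s over Laurent series in x\<close>

text \<open>
  Laurent series are used only as a convenient field that contains $k[x,x^{-1}]$ and carries an
  $x$-adic order.
\<close>

definition of_X :: "'k::field_char_0 poly \<Rightarrow> 'k fls poly" where
  "of_X p = [:fps_to_fls (fps_of_poly p):]"

lemma comm_ring_map_of_X: "comm_ring_map of_X"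
  by unfold_locales
     (simp_all add: of_X_def fps_of_poly_add fps_of_poly_mult fls_times_fps_to_fls one_pCons)

abbreviation xK :: "'k::field_char_0 fls poly" where "xK \<equiv> [:fls_X:]"
abbreviation sK :: "'k::field_char_0 fls poly" where "sK \<equiv> [:0, 1:]"
abbreviation constK :: "'k::field_char_0 \<Rightarrow> 'k fls poly" where "constK c \<equiv> [:fls_const c:]"

lemma of_X_const: "of_X [:c:] = constK c"
  by (simp add: of_X_def fps_of_poly_const)

lemma of_X_var: "of_X [:0, 1:] = xK"
  by (simp add: of_X_def)

lemma of_X_eq_0_iff: "of_X p = 0 \<longleftrightarrow> p = 0"
  by (metis of_X_def pCons_eq_0_iff fps_to_fls_eq_0_iff fps_of_poly_eq_iff fps_of_poly_0)

definition eval2 :: "'k::field_char_0 fls poly \<Rightarrow> 'k poly2 \<Rightarrow> 'k fls poly" where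
  "eval2 t = eval_at of_X t"

definition eval3 :: "'k::field_char_0 fls poly \<Rightarrow> 'k fls poly \<Rightarrow> 'k poly3 \<Rightarrow> 'k fls poly" where
  "eval3 t u = eval_at (eval2 t) u"

lemma comm_ring_map_eval2: "comm_ring_map (eval2 t)"
  unfolding eval2_def by (rule comm_ring_map.comm_ring_map_eval_at[OF comm_ring_map_of_X])

lemma comm_ring_map_eval3: "comm_ring_map (eval3 t u)"
  unfolding eval3_def by (rule comm_ring_map.comm_ring_map_eval_at[OF comm_ring_map_eval2])

lemma eval2_inX2: "eval2 t (inX2 p) = of_X p"
  by (simp add: eval2_def inX2_def comm_ring_map.eval_at_const[OF comm_ring_map_of_X])

lemma eval2_simps:
  "eval2 t (const2 c) = constK c" "eval2 t X2 = xK" "eval2 t S2 = t"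
  using eval2_inX2[of t "[:c:]"] eval2_inX2[of t "[:0, 1:]"]
  by (simp_all add: inX2_def const2_def X2_def of_X_const of_X_var S2_def eval2_def
      comm_ring_map.eval_at_var[OF comm_ring_map_of_X])

lemma eval3_const: "eval3 t u [:p:] = eval2 t p"
  by (simp add: eval3_def comm_ring_map.eval_at_const[OF comm_ring_map_eval2])

lemma eval3_inX3: "eval3 t u (inX3 p) = of_X p"
  using eval2_inX2[of t p] by (simp add: inX3_def inX2_def eval3_const)

lemma eval3_simps:
  "eval3 t u (const3 c) = constK c" "eval3 t u T1 = xK" "eval3 t u T2 = t" "eval3 t u T3 = u"
  using eval2_simps[of t] unfolding const3_def T1_def T2_def const2_def X2_def S2_def
  by (simp_all add: eval3_const)
     (simp add: T3_def eval3_def comm_ring_map.eval_at_var[OF comm_ring_map_eval2])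

lemma T1_power_inX3: "T1 ^ k = inX3 ([:0, 1:] ^ k)"
  by (induction k) (simp_all add: inX3_def T1_def one_pCons)

section \<open>Spanning sets over k[X] modulo an ideal\<close>

text \<open>
  The set $J + \sum_q k[X]\, w_q$. Adding one term at a time makes closure properties
  provable by induction; finite sums are recovered in \<open>span_explicit\<close> below.
\<close>

inductive_set module_span :: "'k::field_char_0 poly3 set \<Rightarrow> (nat \<Rightarrow> 'k poly3) \<Rightarrow> 'k poly3 set"
  for J w where
  base: "p \<in> J \<Longrightarrow> p \<in> module_span J w"
| step: "p \<in> module_span J w \<Longrightarrow> p + inX3 a * w q \<in> module_span J w"

locale span_modulo =
  fixes J :: "'k::field_char_0 poly3 set" and w :: "nat \<Rightarrow> 'k poly3"
  assumes J_0: "0 \<in> J"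
    and J_add: "p \<in> J \<Longrightarrow> q \<in> J \<Longrightarrow> p + q \<in> J"
    and J_mult: "q \<in> J \<Longrightarrow> p * q \<in> J"
begin

abbreviation "M \<equiv> module_span J w"

lemma span_add: assumes "p \<in> M" "q \<in> M" shows "p + q \<in> M"
  using assms(2,1)
proof (induction q)
  case (base q)
  from base(2) show ?case
    by induction (use J_add base(1) in
      \<open>auto intro: module_span.intros simp: add_ac\<close>, metis add.assoc add.commute module_span.step)
next
  case (step q a i)
  then show ?case by (metis add.assoc module_span.step)
qed

lemma span_0: "0 \<in> M" by (rule module_span.base[OF J_0])

lemma span_gen: "inX3 a * w q \<in> M"
  using module_span.step[OF span_0] by simp

lemma span_scale: "p \<in> M \<Longrightarrow> inX3 a * p \<in> M"
proof (induction rule: module_span.induct)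
  case (base p)
  then show ?case by (auto intro: module_span.base J_mult)
next
  case (step p b q)
  have "inX3 a * (inX3 b * w q) = inX3 (a * b) * w q"
    by (simp add: inX3_def mult.assoc)
  then show ?case using span_add[OF step.IH span_gen] by (metis distrib_left)
qed

lemma inX3_uminus_1: "inX3 (-1) = -1"
  by (simp add: inX3_def one_pCons)

lemma span_uminus: "p \<in> M \<Longrightarrow> - p \<in> M"
  using span_scale[of p "-1"] by (simp add: inX3_uminus_1)

lemma span_diff: "p \<in> M \<Longrightarrow> q \<in> M \<Longrightarrow> p - q \<in> M"
  using span_add[of p "- q"] span_uminus by simp

lemma span_sum: "(\<And>i. i \<in> I \<Longrightarrow> c i \<in> M) \<Longrightarrow> sum c I \<in> M"
  by (induction I rule: infinite_finite_induct) (auto intro: span_0 span_add)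

lemma span_mult:
  assumes "\<And>q. t * w q \<in> M" and "p \<in> M"
  shows "t * p \<in> M"
  using assms(2)
proof induction
  case (base p)
  then show ?case by (auto intro: module_span.base J_mult)
next
  case (step p b q)
  have "t * (p + inX3 b * w q) = t * p + inX3 b * (t * w q)"
    by (simp add: algebra_simps)
  then show ?case using span_add[OF step.IH span_scale[OF assms(1)]] by metis
qed

text \<open>
  A $k[X]$-submodule that contains $1$ and is stable under multiplication by the two remaining
  variables is the whole ring, and stability has to be tested on the \<open>w q\<close> only.
\<close>

lemma span_everything:
  assumes T2: "\<And>q. T2 * w q \<in> M" and T3: "\<And>q. T3 * w q \<in> M" and one: "1 \<in> M"
  shows "p \<in> M"
proof -
  have "\<forall>r\<in>M. p * r \<in> M"
  proof (induction p rule: poly3_induct)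
    case (const c)
    then show ?case using span_scale[of _ "[:c:]"] by (simp add: inX3_def const3_def)
  next
    case T1
    then show ?case using span_scale[of _ "[:0, 1:]"] by (simp add: inX3_def T1_def)
  next
    case T2
    then show ?case using span_mult[OF assms(1)] by blast
  next
    case T3
    then show ?case using span_mult[OF assms(2)] by blast
  next
    case (add p q)
    then show ?case by (simp add: distrib_right span_add)
  next
    case (mult p q)
    then show ?case by (simp add: mult.assoc)
  qed
  then show ?thesis using one by force
qed

lemma span_explicit:
  assumes "p \<in> M"
  shows "\<exists>c N. p - (\<Sum>q<N. inX3 (c q) * w q) \<in> J"
  using assms
proof induction
  case (base p)
  then show ?case by (intro exI[of _ "\<lambda>_. 0"] exI[of _ 0]) simp
next
  case (step p a i)
  then obtain c N where c: "p - (\<Sum>q<N. inX3 (c q) * w q) \<in> J" by blast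
  define N' where "N' = max N (Suc i)"
  define c1 where "c1 q = (if q < N then c q else 0)" for q
  define c2 where "c2 q = (if q = i then a else 0)" for q
  have "(\<Sum>q<N'. inX3 (c1 q) * w q) = (\<Sum>q<N. inX3 (c q) * w q)"
    by (rule sum.mono_neutral_cong_right) (auto simp: N'_def c1_def inX3_def)
  moreover have "(\<Sum>q<N'. inX3 (c2 q) * w q) = (\<Sum>q\<in>{i}. inX3 a * w q)"
    by (rule sum.mono_neutral_cong_right) (auto simp: N'_def c2_def inX3_def)
  moreover have "inX3 (c1 q + c2 q) * w q = inX3 (c1 q) * w q + inX3 (c2 q) * w q" for q
  proof -
    have "inX3 (c1 q + c2 q) = inX3 (c1 q) + inX3 (c2 q)" by (simp add: inX3_def)
    then show ?thesis by (simp only: distrib_right)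
  qed
  ultimately have "(\<Sum>q<N'. inX3 (c1 q + c2 q) * w q) =
      (\<Sum>q<N. inX3 (c q) * w q) + inX3 a * w i"
    by (simp add: sum.distrib)
  then have "p + inX3 a * w i - (\<Sum>q<N'. inX3 (c1 q + c2 q) * w q) \<in> J"
    using c by simp
  then show ?case by (intro exI)
qed

end

text \<open>
  The terms with non-zero coefficient have pairwise different degrees, so no cancellation can occur
  in the top degree: the last such term determines the degree and the leading coefficient of the sum.
\<close>

lemma triangular_sum:
  fixes W :: "nat \<Rightarrow> 'k::field_char_0 fls poly"
  assumes W: "\<And>q. degree (W q) = q" "\<And>q. W q \<noteq> 0"
  defines "r \<equiv> \<lambda>N c. \<Sum>q<N. of_X (c q) * W q"
  shows "((\<forall>q<N. c q = 0) \<and> r N c = 0) \<or>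
    (r N c \<noteq> 0 \<and> degree (r N c) < N \<and> (\<forall>q<N. c q \<noteq> 0 \<longrightarrow> q \<le> degree (r N c)) \<and>
     lead_coeff (r N c) = fps_to_fls (fps_of_poly (c (degree (r N c)))) * lead_coeff (W (degree (r N c))))"
proof (induction N)
  case 0
  show ?case by (simp add: r_def)
next
  case (Suc N)
  have r_Suc: "r (Suc N) c = r N c + of_X (c N) * W N"
    by (simp add: r_def)
  show ?case
  proof (cases "c N = 0")
    case True
    then have "r (Suc N) c = r N c" by (simp add: r_Suc of_X_def)
    then show ?thesis using Suc.IH True by (auto simp: less_Suc_eq)
  next
    case False
    have ne: "of_X (c N) \<noteq> 0" using False by (simp add: of_X_eq_0_iff)
    have deg: "degree (of_X (c N) * W N) = N"
      using ne W by (subst degree_mult_eq) (auto simp: of_X_def)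
    have co: "coeff (of_X (c N) * W N) N = fps_to_fls (fps_of_poly (c N)) * lead_coeff (W N)"
      using W by (simp add: of_X_def)
    have nz: "coeff (of_X (c N) * W N) N \<noteq> 0"
      using deg ne W(2) by (metis leading_coeff_0_iff mult_eq_0_iff)
    have low: "coeff (r N c) i = 0" if "i \<ge> N" for i
    proof (cases "r N c = 0")
      case False
      then have "degree (r N c) < i" using Suc.IH that by auto
      then show ?thesis by (rule coeff_eq_0)
    qed simp
    have "degree (r (Suc N) c) \<le> N"
      using low deg by (intro degree_le) (auto simp: r_Suc coeff_eq_0)
    moreover have cN: "coeff (r (Suc N) c) N = coeff (of_X (c N) * W N) N"
      using low by (simp add: r_Suc)
    ultimately have "degree (r (Suc N) c) = N"
      using nz by (metis le_antisym le_degree)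
    then show ?thesis using cN nz co by (intro disjI2) auto
  qed
qed

section \<open>Bases of R and B over k[x]\<close>

lemma type_ring_simps [simp]:
  "carrier ring_of_type_algebra = UNIV" "monoid.mult ring_of_type_algebra = (*)"
  "one ring_of_type_algebra = 1" "ring.zero ring_of_type_algebra = 0"
  "add ring_of_type_algebra = (+)"
  by (auto simp: ring_of_type_algebra_def fun_eq_iff)

lemma fls_X_times_inv: "fls_X * fls_X_inv = (1 :: 'k::field fls)"
  by (simp add: fls_X_times_conv_shift(1) fls_X_inv_conv_shift_1)

lemma xK_power_inv: "xK ^ k * [:fls_X_inv ^ k:] = (1 :: 'k::field_char_0 fls poly)"
proof -
  have "xK ^ k = [:fls_X ^ k :: 'k fls:]" 
    by (induction k) (simp_all add: one_pCons)
  then show ?thesis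
    by (simp flip: power_mult_distrib add: fls_X_times_inv one_pCons mult.commute)
qed

lemma degree_monic_at:
  fixes t :: "'k::field_char_0 fls poly"
  assumes "degree t > 0" "k > 0"
  shows "degree (monic_at of_X c k t) = k * degree t"
    and "lead_coeff (monic_at of_X c k t) = lead_coeff t ^ k"
proof -
  have top: "degree (t ^ k) = k * degree t"
    using assms by (subst degree_power_eq) auto
  have "degree (of_X (c i) * t ^ i) < k * degree t" if "i < k" for i
  proof -
    have "degree (of_X (c i) * t ^ i) \<le> degree (of_X (c i)) + degree (t ^ i)"
      by (rule degree_mult_le)
    also have "\<dots> \<le> i * degree t"
      using degree_power_le[of t i] by (simp add: of_X_def mult.commute)
    also have "\<dots> < k * degree t" using that assms by simp
    finally show ?thesis .
  qed
  then have low: "degree (\<Sum>i<k. of_X (c i) * t ^ i) < degree (t ^ k)"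
    using assms top by (intro degree_sum_less) auto
  show "degree (monic_at of_X c k t) = k * degree t"
    unfolding monic_at_def using top degree_add_eq_left[OF low] by simp
  show "lead_coeff (monic_at of_X c k t) = lead_coeff t ^ k"
    unfolding monic_at_def using lead_coeff_add_le[OF low]
    by (simp add: lead_coeff_power add.commute)
qed

locale double_danielewski =
  fixes n e d m :: nat and f g :: "nat \<Rightarrow> 'k::field_char_0 poly"
  assumes n: "n \<ge> 1" and ne: "(n, e) \<noteq> (1, 0)" and d: "d \<ge> 2" and m: "m \<ge> 2"
begin

definition PK :: "'k fls poly" where "PK = monic_at of_X f d sK"
definition yK :: "'k fls poly" where "yK = [:fls_X_inv ^ n:] * PK"
definition QK :: "'k fls poly" where "QK = monic_at of_X g m yK"
definition zK :: "'k fls poly" where "zK = [:fls_X_inv ^ e:] * (QK - sK)"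

lemma x_y: "xK ^ n * yK = PK"
  unfolding yK_def mult.assoc[symmetric] xK_power_inv by simp

lemma x_z: "xK ^ e * zK = QK - sK"
  unfolding zK_def mult.assoc[symmetric] xK_power_inv by simp

lemma degree_PK: "degree PK = d" "lead_coeff PK = 1"
  using degree_monic_at[of sK d f] d by (simp_all add: PK_def)

lemma degree_yK: "degree yK = d" "lead_coeff yK = fls_X_inv ^ n"
  using degree_PK by (simp_all add: yK_def)

lemma degree_QK: "degree QK = d * m" "lead_coeff QK = fls_X_inv ^ (n * m)"
  using degree_monic_at[of yK m g] degree_yK m d
  by (simp_all add: QK_def mult.commute flip: power_mult)

lemma degree_zK: "degree zK = d * m" "lead_coeff zK = fls_X_inv ^ (n * m + e)"
proof -
  have "2 * 2 \<le> d * m" using d m by (rule mult_le_mono)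
  then have less: "degree (sK :: 'k fls poly) < degree QK" by (simp add: degree_QK)
  have deg: "degree (QK - sK) = degree QK"
    using degree_add_eq_left[of "- sK" QK] less
    by (simp only: degree_minus diff_conv_add_uminus)
  have "lead_coeff (QK - sK) = lead_coeff QK"
    unfolding deg using less by (simp only: coeff_diff coeff_eq_0[OF less] diff_0_right)
  with deg have *: "degree (QK - sK) = d * m" "lead_coeff (QK - sK) = fls_X_inv ^ (n * m)"
    using degree_QK by simp_all
  then show "degree zK = d * m" "lead_coeff zK = fls_X_inv ^ (n * m + e)"
    by (simp_all add: zK_def power_add mult.commute)
qed

abbreviation "eval_R \<equiv> eval3 yK zK"
abbreviation "eval_B \<equiv> eval3 sK yK"
abbreviation eval_A :: "'k poly2 \<Rightarrow> 'k fls poly" where "eval_A \<equiv> eval2 sK"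

abbreviation "sR \<equiv> sR_poly e m g"

lemma eval_R_s: "eval_R sR = sK"
  using x_z by (simp add: sR_poly_def QK_def eval3_inX3 eval3_simps
      comm_ring_map.map_simps[OF comm_ring_map_eval3])

lemma mem_R_ideal_iff: "p \<in> R_ideal n e d m f g \<longleftrightarrow> (\<exists>r. p = r * (T1 ^ n * T2 - monic_at inX3 f d sR))"
  by (auto simp: R_ideal_def cgenideal_def)

lemma mem_B_ideal_iff: "p \<in> B_ideal n d f \<longleftrightarrow> (\<exists>r. p = r * (T1 ^ n * T3 - monic_at inX3 f d T2))"
  by (auto simp: B_ideal_def cgenideal_def)

lemma eval_R_ideal: "p \<in> R_ideal n e d m f g \<Longrightarrow> eval_R p = 0"
  using x_y by (auto simp: mem_R_ideal_iff eval3_inX3 eval3_simps eval_R_s PK_def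
      comm_ring_map.map_simps[OF comm_ring_map_eval3])

lemma eval_B_ideal: "p \<in> B_ideal n d f \<Longrightarrow> eval_B p = 0"
  using x_y by (auto simp: mem_B_ideal_iff eval3_inX3 eval3_simps PK_def
      comm_ring_map.map_simps[OF comm_ring_map_eval3])

lemma span_modulo_R: "span_modulo (R_ideal n e d m f g)"
proof
  show "0 \<in> R_ideal n e d m f g" unfolding mem_R_ideal_iff by (intro exI[of _ 0]) simp
  show "p + q \<in> R_ideal n e d m f g" if "p \<in> R_ideal n e d m f g" "q \<in> R_ideal n e d m f g" for p q
    using that unfolding mem_R_ideal_iff by (metis distrib_right)
  show "p * q \<in> R_ideal n e d m f g" if "q \<in> R_ideal n e d m f g" for p q
    using that unfolding mem_R_ideal_iff by (metis mult.assoc)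
qed

lemma span_modulo_B: "span_modulo (B_ideal n d f)"
proof
  show "0 \<in> B_ideal n d f" unfolding mem_B_ideal_iff by (intro exI[of _ 0]) simp
  show "p + q \<in> B_ideal n d f" if "p \<in> B_ideal n d f" "q \<in> B_ideal n d f" for p q
    using that unfolding mem_B_ideal_iff by (metis distrib_right)
  show "p * q \<in> B_ideal n d f" if "q \<in> B_ideal n d f" for p q
    using that unfolding mem_B_ideal_iff by (metis mult.assoc)
qed

definition basis_R :: "nat \<Rightarrow> 'k poly3" where
  "basis_R q = sR ^ (q mod d) * T2 ^ (q div d mod m) * T3 ^ (q div (d * m))"

definition basis_B :: "nat \<Rightarrow> 'k poly3" where
  "basis_B q = T2 ^ (q mod d) * T3 ^ (q div d)"

text \<open>
  The basis element of index \<open>q\<close> is $s^i y^j z^l$ with $q = i + dj + dml$, the mixed radix expansion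
  of \<open>q\<close>. The power of $x$ in the denominator of its leading coefficient comes from $y$ and $z$,
  whose leading coefficients are $x^{-n}$ and $x^{-(nm+e)}$.
\<close>

definition pole_order :: "nat \<Rightarrow> nat" where
  "pole_order q = n * (q div d mod m) + (n * m + e) * (q div (d * m))"

lemma eval_basis_R: "eval_R (basis_R q) = sK ^ (q mod d) * yK ^ (q div d mod m) * zK ^ (q div (d * m))"
  by (simp add: basis_R_def eval3_simps eval_R_s comm_ring_map.map_simps[OF comm_ring_map_eval3])

lemma eval_basis_B: "eval_B (basis_B q) = sK ^ (q mod d) * yK ^ (q div d)"
  by (simp add: basis_B_def eval3_simps comm_ring_map.map_simps[OF comm_ring_map_eval3])

lemma digits: "q mod d + d * (q div d mod m) + d * m * (q div (d * m)) = q"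
proof -
  have "d * (q div d) + q mod d = q" by simp
  moreover have "m * (q div (d * m)) + q div d mod m = q div d"
    by (simp add: div_mult2_eq)
  ultimately have "d * (m * (q div (d * m)) + q div d mod m) + q mod d = q" by simp
  then show ?thesis by (simp only: distrib_left mult.assoc add_ac)
qed

lemma K_nonzero: "sK \<noteq> (0 :: 'k fls poly)" "yK \<noteq> 0" "zK \<noteq> 0"
  using degree_yK degree_zK d m by auto

lemma degree_basis_R:
  "degree (eval_R (basis_R q)) = q"
  "lead_coeff (eval_R (basis_R q)) = fls_X_inv ^ pole_order q"
proof -
  have "degree (eval_R (basis_R q)) = q mod d + (q div d mod m) * d + (q div (d * m)) * (d * m)"
    using K_nonzero by (simp add: eval_basis_R degree_mult_eq degree_power_eq degree_yK degree_zK)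
  also have "\<dots> = q" using digits[of q] by (simp add: mult.commute)
  finally show "degree (eval_R (basis_R q)) = q" .
  show "lead_coeff (eval_R (basis_R q)) = fls_X_inv ^ pole_order q"
    unfolding eval_basis_R lead_coeff_mult lead_coeff_power degree_yK(2) degree_zK(2)
    by (simp add: pole_order_def power_add power_mult)
qed

lemma basis_R_nonzero: "eval_R (basis_R q) \<noteq> 0"
  using K_nonzero by (simp add: eval_basis_R)

lemma basis_B_nonzero: "eval_B (basis_B q) \<noteq> 0"
  using K_nonzero by (simp add: eval_basis_B)

lemma degree_basis_B: "degree (eval_B (basis_B q)) = q"
  using K_nonzero by (simp add: eval_basis_B degree_mult_eq degree_power_eq degree_yK)

lemma T2_power_m: "T2 ^ m = sR + inX3 ([:0, 1:] ^ e) * T3 - (\<Sum>j<m. inX3 (g j) * T2 ^ j)"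
  by (simp add: sR_poly_def monic_at_def T1_power_inX3)

text \<open>
  Multiplication by $Y$ leaves the range $j < m$ only through $Y^m$, which the definition of $s$ rewrites
  as $s + X^e Z$ minus lower terms. This may produce $s^d$, which the defining relation rewrites as
  $X^n Y$ minus lower terms; $Y$ is again in range because $m \ge 2$.
\<close>

lemma spanning_R: "p \<in> module_span (R_ideal n e d m f g) basis_R"
proof -
  interpret span_modulo "R_ideal n e d m f g" basis_R by (rule span_modulo_R)
  have gen: "sR ^ i * T2 ^ j * T3 ^ l \<in> M" if "i < d" "j < m" for i j l
  proof -
    define q where "q = i + d * (j + m * l)"
    have "q mod d = i" "q div d = j + m * l" using that by (auto simp: q_def)
    moreover from this have "q div d mod m = j" "q div (d * m) = l"
      using that by (auto simp: div_mult2_eq)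
    ultimately have "inX3 1 * basis_R q = sR ^ i * T2 ^ j * T3 ^ l"
      by (simp add: basis_R_def inX3_def flip: one_pCons)
    then show ?thesis using span_gen by metis
  qed
  have s_pow: "sR ^ i * T3 ^ l \<in> M" if "i \<le> d" for i l
  proof (cases "i = d")
    case False
    then show ?thesis using gen[of i 0 l] that m by simp
  next
    case True
    define G where "G = T1 ^ n * T2 - monic_at inX3 f d sR"
    have sd: "sR ^ d = inX3 ([:0, 1:] ^ n) * T2 - (\<Sum>i<d. inX3 (f i) * sR ^ i) - G"
      by (simp add: G_def monic_at_def T1_power_inX3)
    have "sR ^ i * T3 ^ l = inX3 ([:0, 1:] ^ n) * (sR ^ 0 * T2 ^ 1 * T3 ^ l)
        - (\<Sum>i<d. inX3 (f i) * (sR ^ i * T2 ^ 0 * T3 ^ l)) - T3 ^ l * G"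
      unfolding True sd by (simp add: algebra_simps sum_distrib_left)
    moreover have "T3 ^ l * G \<in> M"
      by (rule module_span.base) (auto simp: mem_R_ideal_iff G_def)
    ultimately show ?thesis
      using gen[of 0 1 l] gen[of _ 0 l] m d by (auto intro!: span_diff span_sum span_scale)
  qed
  show ?thesis
  proof (rule span_everything)
    show "1 \<in> M" using gen[of 0 0 0] d m by simp
    fix q
    define i j l where "i = q mod d" and "j = q div d mod m" and "l = q div (d * m)"
    have ij: "i < d" "j < m" using d m by (auto simp: i_def j_def)
    have q: "basis_R q = sR ^ i * T2 ^ j * T3 ^ l"
      by (simp add: basis_R_def i_def j_def l_def)
    show "T3 * basis_R q \<in> M"
      using gen[OF ij, of "Suc l"] by (simp add: q algebra_simps)
    show "T2 * basis_R q \<in> M"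
    proof (cases "Suc j < m")
      case True
      then show ?thesis using gen[of i "Suc j" l] ij by (simp add: q algebra_simps)
    next
      case False
      then have "m = Suc j" using ij by simp
      moreover have "T2 * basis_R q = T2 ^ Suc j * (sR ^ i * T3 ^ l)"
        by (simp add: q algebra_simps)
      ultimately have "T2 * basis_R q = T2 ^ m * (sR ^ i * T3 ^ l)"
        by (simp only:)
      also have "\<dots> = sR ^ Suc i * T3 ^ l + inX3 ([:0, 1:] ^ e) * (sR ^ i * T3 ^ Suc l)
          - (\<Sum>j<m. inX3 (g j) * (sR ^ i * T2 ^ j * T3 ^ l))"
        unfolding T2_power_m by (simp add: algebra_simps sum_distrib_left)
      finally show ?thesis
        using ij gen[of i _ l]
        by (auto intro!: span_diff span_add span_sum span_scale s_pow simp del: power_Suc)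
    qed
  qed
qed

lemma spanning_B: "p \<in> module_span (B_ideal n d f) basis_B"
proof -
  interpret span_modulo "B_ideal n d f" basis_B by (rule span_modulo_B)
  have gen: "T2 ^ i * T3 ^ l \<in> M" if "i < d" for i l
  proof -
    have "inX3 1 * basis_B (i + d * l) = T2 ^ i * T3 ^ l"
      using that by (simp add: basis_B_def inX3_def flip: one_pCons)
    then show ?thesis using span_gen by metis
  qed
  show ?thesis
  proof (rule span_everything)
    show "1 \<in> M" using gen[of 0 0] d by simp
    fix q
    define i l where "i = q mod d" and "l = q div d"
    have i: "i < d" using d by (auto simp: i_def)
    have q: "basis_B q = T2 ^ i * T3 ^ l"
      by (simp add: basis_B_def i_def l_def)
    show "T3 * basis_B q \<in> M"
      using gen[OF i, of "Suc l"] by (simp add: q algebra_simps)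
    show "T2 * basis_B q \<in> M"
    proof (cases "Suc i < d")
      case True
      then show ?thesis using gen[of "Suc i" l] by (simp add: q algebra_simps)
    next
      case False
      define G :: "'k poly3" where "G = T1 ^ n * T3 - monic_at inX3 f d T2"
      have "d = Suc i" using i False by simp
      moreover have "T2 * basis_B q = T2 ^ Suc i * T3 ^ l"
        by (simp add: q algebra_simps)
      ultimately have "T2 * basis_B q = T2 ^ d * T3 ^ l"
        by (simp only:)
      also have "T2 ^ d = inX3 ([:0, 1:] ^ n) * T3 - (\<Sum>i<d. inX3 (f i) * T2 ^ i) - G"
        by (simp add: G_def monic_at_def T1_power_inX3)
      also have "\<dots> * T3 ^ l = inX3 ([:0, 1:] ^ n) * (T2 ^ 0 * T3 ^ Suc l)
          - (\<Sum>i<d. inX3 (f i) * (T2 ^ i * T3 ^ l)) - T3 ^ l * G"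
        by (simp add: algebra_simps sum_distrib_left)
      moreover have "T3 ^ l * G \<in> M"
        by (rule module_span.base) (auto simp: mem_B_ideal_iff G_def)
      ultimately show ?thesis
        using gen[of 0 "Suc l"] gen[of _ l] d by (auto intro!: span_diff span_sum span_scale simp del: power_Suc)
    qed
  qed
qed

end

lemma (in span_modulo) eval_expansion:
  assumes J: "\<And>p. p \<in> J \<Longrightarrow> eval3 t u p = 0" and p: "p \<in> M"
  obtains c N where "p - (\<Sum>q<N. inX3 (c q) * w q) \<in> J"
    and "eval3 t u p = (\<Sum>q<N. of_X (c q) * eval3 t u (w q))"
proof -
  obtain c N where c: "p - (\<Sum>q<N. inX3 (c q) * w q) \<in> J"
    using span_explicit[OF p] by blast
  from J[OF this] have "eval3 t u p = (\<Sum>q<N. of_X (c q) * eval3 t u (w q))"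
    by (simp add: eval3_inX3 comm_ring_map.map_simps[OF comm_ring_map_eval3])
  with c show ?thesis by (rule that)
qed

text \<open>
  Modulo \<open>J\<close> every \<open>p\<close> is a combination of the \<open>w q\<close>, and their values are linearly independent by
  \<open>triangular_sum\<close>. So a combination with value zero is zero.
\<close>

lemma (in span_modulo) kernel_eval:
  assumes J: "\<And>p. p \<in> J \<Longrightarrow> eval3 t u p = 0" and p: "p \<in> M"
    and w: "\<And>q. degree (eval3 t u (w q)) = q" "\<And>q. eval3 t u (w q) \<noteq> 0"
  shows "eval3 t u p = 0 \<longleftrightarrow> p \<in> J"
proof
  assume 0: "eval3 t u p = 0"
  obtain c N where c: "p - (\<Sum>q<N. inX3 (c q) * w q) \<in> J"
    and ev: "eval3 t u p = (\<Sum>q<N. of_X (c q) * eval3 t u (w q))"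
    using eval_expansion[OF J p] by blast
  have "\<forall>q<N. c q = 0"
    using triangular_sum[of "\<lambda>q. eval3 t u (w q)" N c, OF w] 0 ev by auto
  then have "(\<Sum>q<N. inX3 (c q) * w q) = 0" by (simp add: inX3_def)
  with c show "p \<in> J" by simp
qed (rule J)

context double_danielewski
begin

lemma kernel_R: "eval_R p = 0 \<longleftrightarrow> p \<in> R_ideal n e d m f g"
  by (rule span_modulo.kernel_eval[OF span_modulo_R eval_R_ideal spanning_R degree_basis_R(1) basis_R_nonzero])

lemma kernel_B: "eval_B p = 0 \<longleftrightarrow> p \<in> B_ideal n d f"
  by (rule span_modulo.kernel_eval[OF span_modulo_B eval_B_ideal spanning_B degree_basis_B basis_B_nonzero])

lemma expansion_R:
  assumes "r \<in> range eval_R"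
  obtains c N where "r = (\<Sum>q<N. of_X (c q) * eval_R (basis_R q))"
  using assms span_modulo.eval_expansion[OF span_modulo_R eval_R_ideal spanning_R] by blast

lemma lead_coeff_R:
  assumes "r \<in> range eval_R" "r \<noteq> 0"
  shows "\<exists>c. lead_coeff r = fps_to_fls (fps_of_poly c) * fls_X_inv ^ pole_order (degree r)"
proof -
  obtain c N where r: "r = (\<Sum>q<N. of_X (c q) * eval_R (basis_R q))"
    using assms(1) by (rule expansion_R)
  note triangular_sum[of "\<lambda>q. eval_R (basis_R q)" N c, OF degree_basis_R(1) basis_R_nonzero,
      folded r]
  with assms(2) have "lead_coeff r =
      fps_to_fls (fps_of_poly (c (degree r))) * lead_coeff (eval_R (basis_R (degree r)))"
    by blast
  then show ?thesis unfolding degree_basis_R(2) by blast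
qed

text \<open>
  Only the basis elements $1$ and $s$ have degree at most $1$: since $d \ge 2$, the element $y$ has
  degree $d > 1$, and $s$ is the basis element of index $1$.
\<close>

lemma degree_le_1_R:
  assumes "r \<in> range eval_R" "degree r \<le> 1"
  shows "r \<in> range eval_A"
proof -
  obtain c N where r: "r = (\<Sum>q<N. of_X (c q) * eval_R (basis_R q))"
    using assms(1) by (rule expansion_R)
  have c: "c q = 0" if q: "q < N" "1 < q" for q
  proof (rule ccontr)
    assume "c q \<noteq> 0"
    then have "q \<le> degree r"
      using triangular_sum[of "\<lambda>q. eval_R (basis_R q)" N c, OF degree_basis_R(1) basis_R_nonzero,
          folded r] q by blast
    with assms(2) q show False by simp
  qed
  have "r = (\<Sum>q\<in>{..<N} \<inter> {..<2}. of_X (c q) * eval_R (basis_R q))"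
    unfolding r
  proof (rule sum.mono_neutral_right)
    show "\<forall>q\<in>{..<N} - {..<N} \<inter> {..<2}. of_X (c q) * eval_R (basis_R q) = 0"
    proof
      fix q assume "q \<in> {..<N} - {..<N} \<inter> {..<2}"
      then have "q < N" "1 < q" by auto
      then show "of_X (c q) * eval_R (basis_R q) = 0" using c by (simp add: of_X_def)
    qed
  qed auto
  also have "\<dots> = (\<Sum>q\<in>{..<N} \<inter> {..<2}. eval_A (inX2 (c q) * S2 ^ q))"
  proof (rule sum.cong[OF refl])
    fix q assume "q \<in> {..<N} \<inter> {..<2}"
    then have "q < d" using d by auto
    then have "eval_R (basis_R q) = sK ^ q"
      by (simp add: eval_basis_R div_mult2_eq)
    then show "of_X (c q) * eval_R (basis_R q) = eval_A (inX2 (c q) * S2 ^ q)"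
      by (simp only: eval2_inX2 eval2_simps comm_ring_map.map_mult[OF comm_ring_map_eval2]
          comm_ring_map.map_power[OF comm_ring_map_eval2])
  qed
  also have "\<dots> = eval_A (\<Sum>q\<in>{..<N} \<inter> {..<2}. inX2 (c q) * S2 ^ q)"
    by (simp add: comm_ring_map.map_sum[OF comm_ring_map_eval2])
  finally show ?thesis by simp
qed

end

section \<open>Leading terms\<close>

notation fls_nth (infixl "$$" 75)

text \<open>
  The coefficient of $x^a s^q$. Negative \<open>q\<close> is admitted because a derivation may shift
  the exponent of \<open>s\<close> by $-1$.
\<close>

definition bicoeff :: "'k::field_char_0 fls poly \<Rightarrow> int \<Rightarrow> int \<Rightarrow> 'k" where
  "bicoeff r q a = (if q < 0 then 0 else coeff r (nat q) $$ a)"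

text \<open>
  The coefficient \<open>c\<close> may be zero: then nothing is known about the true leading
  term, but the bounds on the exponents survive. In this form leading terms add and multiply
  without case distinctions.
\<close>

definition leading_term :: "'k::field_char_0 fls poly \<Rightarrow> int \<Rightarrow> int \<Rightarrow> 'k \<Rightarrow> bool" where
  "leading_term r q a c \<longleftrightarrow>
     (\<forall>q'>q. \<forall>a'. bicoeff r q' a' = 0) \<and> (\<forall>a'<a. bicoeff r q a' = 0) \<and> bicoeff r q a = c"

definition ddx :: "'k::field_char_0 fls poly \<Rightarrow> 'k fls poly" where
  "ddx r = map_poly fls_deriv r"

lemma coeff_ddx: "coeff (ddx r) i = fls_deriv (coeff r i)"
  by (simp add: ddx_def coeff_map_poly)

lemma ddx_add: "ddx (r + t) = ddx r + ddx t"
  by (simp add: poly_eq_iff coeff_ddx)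

lemma ddx_mult: "ddx (r * t) = ddx r * t + r * ddx t"
  by (simp add: poly_eq_iff coeff_ddx coeff_mult fls_deriv_sum sum.distrib add.commute)

lemma ddx_simps: "ddx (constK c) = 0" "ddx xK = 1" "ddx sK = 0"
  by (simp_all add: ddx_def map_poly_pCons one_pCons)

lemma bicoeff_0 [simp]: "bicoeff 0 q a = 0"
  by (auto simp: bicoeff_def)

lemma bicoeff_add: "bicoeff (r + t) q a = bicoeff r q a + bicoeff t q a"
  by (simp add: bicoeff_def)

lemma bicoeff_xK: "bicoeff (xK * r) q a = bicoeff r q (a - 1)"
  by (simp add: bicoeff_def fls_X_times_conv_shift)

lemma bicoeff_sK: "bicoeff (sK * r) q a = bicoeff r (q - 1) a"
proof (cases "q \<le> 0")
  case False
  then have "nat q = Suc (nat (q - 1))" by simp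
  then show ?thesis using False by (simp add: bicoeff_def)
next
  case True
  then show ?thesis by (cases "q = 0") (auto simp: bicoeff_def)
qed

lemma bicoeff_x_ddx: "bicoeff (xK * ddx r) q a = of_int a * bicoeff r q a"
  unfolding bicoeff_xK by (simp add: bicoeff_def coeff_ddx)

lemma bicoeff_s_pderiv: "bicoeff (sK * pderiv r) q a = of_int q * bicoeff r q a"
proof (cases "q \<le> 0")
  case False
  then have "nat q = Suc (nat (q - 1))" by simp
  moreover have "of_int q = (of_nat (nat q) :: 'a)" using False by simp
  ultimately show ?thesis using False
    unfolding bicoeff_sK by (simp add: bicoeff_def coeff_pderiv fls_of_nat del: of_nat_Suc of_nat_nat)
next
  case True
  then show ?thesis unfolding bicoeff_sK by (cases "q = 0") (auto simp: bicoeff_def)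
qed

lemma fls_mult_lowest:
  fixes F G :: "'k::field_char_0 fls"
  assumes F: "\<And>k. k < a \<Longrightarrow> F $$ k = 0" and G: "\<And>k. k < b \<Longrightarrow> G $$ k = 0"
  shows "(F * G) $$ (a + b) = F $$ a * G $$ b" "k < a + b \<Longrightarrow> (F * G) $$ k = 0"
proof -
  show "(F * G) $$ (a + b) = F $$ a * G $$ b"
  proof (cases "F = 0 \<or> G = 0")
    case False
    then have le: "a \<le> fls_subdegree F" "b \<le> fls_subdegree G"
      using F G by (auto intro: fls_subdegree_geI)
    show ?thesis
    proof (cases "fls_subdegree F = a \<and> fls_subdegree G = b")
      case True
      then show ?thesis using fls_times_base[of F G] by simp
    next
      case False
      then have "a < fls_subdegree F \<or> b < fls_subdegree G" using le by auto
      moreover from this have "(F * G) $$ (a + b) = 0"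
        using le by (intro fls_times_nth_eq0) auto
      ultimately show ?thesis by auto
    qed
  qed auto
  show "(F * G) $$ k = 0" if "k < a + b"
  proof (cases "F = 0 \<or> G = 0")
    case False
    then have "a \<le> fls_subdegree F" "b \<le> fls_subdegree G"
      using F G by (auto intro: fls_subdegree_geI)
    with that show ?thesis by (intro fls_times_nth_eq0) auto
  qed auto
qed

lemma coeff_mult_top:
  fixes r t :: "'a::idom poly"
  assumes "degree r \<le> k" "degree t \<le> l"
  shows "coeff (r * t) (k + l) = coeff r k * coeff t l"
proof (cases "degree r = k \<and> degree t = l")
  case True
  then show ?thesis using coeff_mult_degree_sum[of r t] by simp
next
  case False
  then have "degree r < k \<or> degree t < l" using assms by auto
  moreover from this have "degree (r * t) < k + l"
    using degree_mult_le[of r t] assms by linarith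
  ultimately show ?thesis by (auto simp: coeff_eq_0)
qed

lemma bicoeff_eq_0_imp: assumes "\<And>a. bicoeff r (int i) a = 0" shows "coeff r i = 0"
  using assms by (intro fls_eqI) (simp add: bicoeff_def)

lemma leading_term_degree:
  assumes "leading_term r q a c" "q \<ge> 0" shows "degree r \<le> nat q"
proof (rule degree_le, intro allI impI)
  fix i assume "nat q < i"
  then have "q < int i" by simp
  then show "coeff r i = 0"
    using assms(1) by (intro bicoeff_eq_0_imp) (simp add: leading_term_def)
qed

lemma leading_term_negative:
  assumes "leading_term r q a c" "q < 0" shows "r = 0" "c = 0"
proof -
  have "coeff r i = 0" for i
    using assms by (intro bicoeff_eq_0_imp) (simp add: leading_term_def)
  then show "r = 0" by (simp add: poly_eq_iff)
  then show "c = 0" using assms by (simp add: leading_term_def bicoeff_def)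
qed

lemma leading_term_0: "leading_term 0 q a 0"
  by (simp add: leading_term_def)

lemma leading_term_mult:
  assumes r: "leading_term r q a c" and t: "leading_term t q' a' c'"
  shows "leading_term (r * t) (q + q') (a + a') (c * c')"
proof (cases "q < 0 \<or> q' < 0")
  case True
  then have "(r = 0 \<and> c = 0) \<or> (t = 0 \<and> c' = 0)"
    using leading_term_negative r t by blast
  then have "r * t = 0" "c * c' = 0" by auto
  then show ?thesis by (simp only: leading_term_0)
next
  case False
  then have q: "q \<ge> 0" "q' \<ge> 0" by auto
  have deg: "degree r \<le> nat q" "degree t \<le> nat q'"
    using leading_term_degree r t q by auto
  have sum: "nat (q + q') = nat q + nat q'" using q by (rule nat_add_distrib)
  have "bicoeff (r * t) q'' b = 0" if "q'' > q + q'" for q'' b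
  proof -
    have "degree (r * t) < nat q''"
      using degree_mult_le[of r t] deg q that by linarith
    then show ?thesis using q that by (simp add: bicoeff_def coeff_eq_0)
  qed
  moreover have top: "bicoeff (r * t) (q + q') b = (coeff r (nat q) * coeff t (nat q')) $$ b" for b
    using q coeff_mult_top[OF deg] by (simp add: bicoeff_def sum)
  moreover have F: "coeff r (nat q) $$ k = 0" if "k < a" for k
    using r that q by (auto simp: leading_term_def bicoeff_def)
  moreover have G: "coeff t (nat q') $$ k = 0" if "k < a'" for k
    using t that q by (auto simp: leading_term_def bicoeff_def)
  moreover have "coeff r (nat q) $$ a = c" "coeff t (nat q') $$ a' = c'"
    using r t q by (auto simp: leading_term_def bicoeff_def)
  ultimately show ?thesis
    unfolding leading_term_def top
    using fls_mult_lowest[of a "coeff r (nat q)" a' "coeff t (nat q')"] by auto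
qed

lemma leading_term_add:
  "leading_term r q a c \<Longrightarrow> leading_term t q a c' \<Longrightarrow> leading_term (r + t) q a (c + c')"
  by (simp add: leading_term_def bicoeff_add)

lemma leading_term_x_ddx:
  "leading_term r q a c \<Longrightarrow> leading_term (xK * ddx r) q a (of_int a * c)"
  unfolding leading_term_def bicoeff_x_ddx by simp

lemma leading_term_s_pderiv:
  "leading_term r q a c \<Longrightarrow> leading_term (sK * pderiv r) q a (of_int q * c)"
  unfolding leading_term_def bicoeff_s_pderiv by simp

lemma leading_term_sK_iff: "leading_term (sK * r) (q + 1) a c \<longleftrightarrow> leading_term r q a c"
proof -
  have "(\<forall>q'>q + 1. \<forall>a'. bicoeff r (q' - 1) a' = 0) \<longleftrightarrow> (\<forall>q'>q. \<forall>a'. bicoeff r q' a' = 0)"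
    by (metis add_diff_cancel_right' less_diff_eq)
  then show ?thesis by (simp only: leading_term_def bicoeff_sK add_diff_cancel_right')
qed

lemma leading_term_xK_iff: "leading_term (xK * r) q (a + 1) c \<longleftrightarrow> leading_term r q a c"
proof -
  have "(\<forall>a'<a + 1. bicoeff r q (a' - 1) = 0) \<longleftrightarrow> (\<forall>a'<a. bicoeff r q a' = 0)"
    by (metis add_diff_cancel_right' add_less_cancel_right diff_add_cancel)
  moreover have "(\<forall>q'>q. \<forall>a'. bicoeff r q' (a' - 1) = 0) \<longleftrightarrow> (\<forall>q'>q. \<forall>a'. bicoeff r q' a' = 0)"
    by (metis add_diff_cancel_right')
  ultimately show ?thesis by (simp only: leading_term_def bicoeff_xK add_diff_cancel_right')
qed

lemma leading_term_of_lead_coeff: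
  assumes "lead_coeff r = fls_X_inv ^ k"
  shows "leading_term r (int (degree r)) (- int k) 1"
  using assms by (auto simp: leading_term_def bicoeff_def coeff_eq_0)

text \<open>
  For the pair of coefficients of a derivation one common exponent is needed at which at least one
  of the two is non-zero.
\<close>

lemma common_leading_term:
  fixes r t :: "'k::field_char_0 fls poly"
  assumes "r \<noteq> 0 \<or> t \<noteq> 0"
  obtains q a c c' where "leading_term r q a c" "leading_term t q a c'" "c \<noteq> 0 \<or> c' \<noteq> 0"
proof -
  define M where "M = max (degree r) (degree t)"
  define F G where "F = coeff r M" and "G = coeff t M"
  have FG: "F \<noteq> 0 \<or> G \<noteq> 0"
  proof (cases "degree t \<le> degree r \<and> r \<noteq> 0")
    case True
    then show ?thesis by (simp add: M_def F_def)
  next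
    case False
    then have "M = degree t" "t \<noteq> 0" using assms by (auto simp: M_def)
    then show ?thesis by (simp add: G_def)
  qed
  define a where "a = (if F = 0 then fls_subdegree G else if G = 0 then fls_subdegree F
    else min (fls_subdegree F) (fls_subdegree G))"
  have low: "F $$ k = 0" "G $$ k = 0" if "k < a" for k
    using that by (auto simp: a_def split: if_splits)
  have top: "bicoeff r q k = 0" "bicoeff t q k = 0" if "q > int M" for q k
  proof -
    have "degree r < nat q" "degree t < nat q" using that by (auto simp: M_def)
    then show "bicoeff r q k = 0" "bicoeff t q k = 0" by (auto simp: bicoeff_def coeff_eq_0)
  qed
  have "bicoeff r (int M) k = F $$ k" "bicoeff t (int M) k = G $$ k" for k
    by (simp_all add: bicoeff_def F_def G_def)
  then have "leading_term r (int M) a (F $$ a)" "leading_term t (int M) a (G $$ a)"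
    using top low by (simp_all add: leading_term_def)
  moreover have "F $$ a \<noteq> 0 \<or> G $$ a \<noteq> 0"
    using FG by (auto simp: a_def min_def)
  ultimately show ?thesis by (rule that)
qed

section \<open>Locally nilpotent derivations of R\<close>

text \<open>
  The hypothesis on $s$ forces $1 + \delta \equiv 0 \pmod d$, since otherwise its left side would be
  at least $B$. Hence $A - 1 \ge B(d-1)$, and likewise $H - 1 \ge B(d-1)$ if $H > 0$. In that
  case $dB = H + nA \ge 2B(d-1) + 2 > dB$. If $H = 0$, the two equations give $Z + eA = 0$, so
  $e = 0$ and $n \ge 2$, and then $dB = nA \ge 2A \ge 2B(d-1) + 2 > dB$.
\<close>

lemma weights_inconsistent:
  fixes A B H Z \<delta> :: int and n e d m :: nat
  assumes n: "n \<ge> 1" and ne: "(n, e) \<noteq> (1, 0)" and d: "d \<ge> 2" and m: "m \<ge> 2"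
    and "A > 0" "B \<ge> 0" "H \<ge> 0" "Z \<ge> 0"
    and y: "int d * B = H + int n * A" and z: "int (d * m) * B = Z + int (n * m + e) * A"
    and x': "B * (\<delta> mod int d) \<le> A - 1" and s': "B * ((1 + \<delta>) mod int d) \<le> B - 1"
    and y': "H > 0 \<Longrightarrow> B * ((int d + \<delta>) mod int d) \<le> H - 1"
  shows False
proof -
  have nA: "int n * A \<ge> A" using n \<open>A > 0\<close> by (simp add: mult_le_cancel_right1)
  then have "int d * B > 0" using y \<open>A > 0\<close> \<open>H \<ge> 0\<close> by linarith
  then have "B > 0" using d by (simp add: zero_less_mult_iff)
  have "(1 + \<delta>) mod int d = 0"
  proof (rule ccontr)
    assume "(1 + \<delta>) mod int d \<noteq> 0"
    moreover have "(1 + \<delta>) mod int d \<ge> 0" using d by simp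
    ultimately have "1 \<le> (1 + \<delta>) mod int d" by linarith
    then have "B * 1 \<le> B * ((1 + \<delta>) mod int d)" using \<open>B > 0\<close> by (intro mult_left_mono) auto
    with s' show False by linarith
  qed
  then obtain k where "1 + \<delta> = int d * k" by (auto simp: mod_eq_0_iff_dvd elim: dvdE)
  then have "\<delta> = (int d - 1) + int d * (k - 1)" by (simp add: algebra_simps)
  then have "\<delta> mod int d = (int d - 1) mod int d" by (simp only: mod_mult_self2)
  then have \<delta>: "\<delta> mod int d = int d - 1" using d by (simp only: mod_pos_pos_trivial)
  have two: "2 * (B * (int d - 1)) \<ge> int d * B"
  proof -
    have "B * int d \<ge> B * 2" using d \<open>B > 0\<close> by (intro mult_left_mono) auto
    then show ?thesis by (simp add: algebra_simps)
  qed
  have x'': "B * (int d - 1) \<le> A - 1" using x' \<delta> by simp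
  show False
  proof (cases "H > 0")
    case True
    then have "B * (int d - 1) \<le> H - 1" using y' \<delta> by simp
    then show False using x'' two y nA by linarith
  next
    case False
    then have "H = 0" using \<open>H \<ge> 0\<close> by simp
    then have "int m * (int n * A) = Z + int (n * m + e) * A"
      using y z by (metis add_0 mult.assoc mult.commute of_nat_mult)
    then have "Z + int e * A = 0" by (simp add: algebra_simps)
    moreover have "int e * A \<ge> 0" using \<open>A > 0\<close> by simp
    ultimately have "int e * A = 0" using \<open>Z \<ge> 0\<close> by linarith
    then have "e = 0" using \<open>A > 0\<close> by simp
    then have "n \<ge> 2" using n ne by auto
    then have "int n * A \<ge> 2 * A" using \<open>A > 0\<close> by (intro mult_right_mono) auto
    then show False using x'' two y \<open>H = 0\<close> by linarith
  qed
qed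

text \<open>
  Most membership claims below concern subsets of $k((x))[s]$ that contain $k[x]$, for instance the
  elements on which two derivations agree. They propagate along $x, s, y, z$ by these closure rules.
\<close>

locale K_subalgebra =
  fixes T :: "'k::field_char_0 fls poly set"
  assumes const_mem: "constK c \<in> T" and x_mem: "xK \<in> T"
    and add_mem: "a \<in> T \<Longrightarrow> b \<in> T \<Longrightarrow> a + b \<in> T"
    and mult_mem: "a \<in> T \<Longrightarrow> b \<in> T \<Longrightarrow> a * b \<in> T"
begin

lemma zero_mem: "0 \<in> T" and one_mem: "1 \<in> T"
  using const_mem[of 0] const_mem[of 1] by (simp_all add: one_pCons)

lemma diff_mem: "a \<in> T \<Longrightarrow> b \<in> T \<Longrightarrow> a - b \<in> T"
  using add_mem[of a "constK (- 1) * b"] mult_mem[OF const_mem, of b "- 1"] by simp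

lemma power_mem: "a \<in> T \<Longrightarrow> a ^ k \<in> T"
  by (induction k) (simp_all add: one_mem mult_mem)

lemma sum_mem: "(\<And>i. i \<in> I \<Longrightarrow> c i \<in> T) \<Longrightarrow> sum c I \<in> T"
  by (induction I rule: infinite_finite_induct) (simp_all add: zero_mem add_mem)

lemma of_X_mem: "of_X p \<in> T"
proof (induction p rule: poly_ring_induct)
  case (const a)
  show ?case unfolding of_X_const by (rule const_mem)
next
  case var
  show ?case unfolding of_X_var by (rule x_mem)
qed (simp_all only: comm_ring_map.map_add[OF comm_ring_map_of_X]
    comm_ring_map.map_mult[OF comm_ring_map_of_X] add_mem mult_mem)

lemma monic_at_mem: "t \<in> T \<Longrightarrow> monic_at of_X c k t \<in> T"
  unfolding monic_at_def by (intro add_mem power_mem sum_mem mult_mem of_X_mem)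

lemma eval2_mem: "t \<in> T \<Longrightarrow> eval2 t p \<in> T"
  by (induction p rule: poly2_induct)
     (simp_all only: eval2_simps const_mem x_mem add_mem mult_mem
       comm_ring_map.map_add[OF comm_ring_map_eval2] comm_ring_map.map_mult[OF comm_ring_map_eval2])

lemma eval3_mem: "t \<in> T \<Longrightarrow> u \<in> T \<Longrightarrow> eval3 t u p \<in> T"
  by (induction p rule: poly3_induct)
     (simp_all only: eval3_simps const_mem x_mem add_mem mult_mem
       comm_ring_map.map_add[OF comm_ring_map_eval3] comm_ring_map.map_mult[OF comm_ring_map_eval3])

end

lemma K_subalgebra_range_eval3: "K_subalgebra (range (eval3 t u))"
proof
  show "constK c \<in> range (eval3 t u)" for c
    unfolding eval3_simps(1)[of t u c, symmetric] by (rule rangeI)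
  show "xK \<in> range (eval3 t u)"
    unfolding eval3_simps(2)[of t u, symmetric] by (rule rangeI)
qed (auto simp flip: comm_ring_map.map_add[OF comm_ring_map_eval3]
      comm_ring_map.map_mult[OF comm_ring_map_eval3])

context double_danielewski
begin

abbreviation "RR \<equiv> range eval_R"

lemma K_subalgebra_RR: "K_subalgebra RR"
  by (rule K_subalgebra_range_eval3)

lemma RR_gens: "xK \<in> RR" "sK \<in> RR" "yK \<in> RR" "zK \<in> RR"
  using eval3_simps(2-4)[of yK zK] eval_R_s by (metis rangeI)+

text \<open>
  A leading exponent $(q,a)$ of an element of \<open>R\<close> with $q = i + dj + dml$ satisfies
  $a \ge -nj - (nm+e)l$. Hence its weight is at least $Bi + Hj + Zl \ge Bi$.
\<close>

lemma weight_bound: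
  fixes A B H Z :: int
  assumes r: "r \<in> RR" "leading_term r q a c" "c \<noteq> 0"
    and "A \<ge> 0" "H \<ge> 0" "Z \<ge> 0"
    and y: "int d * B = H + int n * A" and z: "int (d * m) * B = Z + int (n * m + e) * A"
  shows "B * (q mod int d) \<le> A * a + B * q"
proof -
  have "r \<noteq> 0"
    using r(2,3) by (auto simp: leading_term_def)
  have q: "q \<ge> 0" using leading_term_negative(2)[OF r(2)] r(3) by force
  have co: "coeff r (nat q) $$ a = c" using r(2) q by (simp add: leading_term_def bicoeff_def)
  have "degree r = nat q"
    using leading_term_degree[OF r(2) q] le_degree[of r "nat q"] co r(3) by fastforce
  then obtain b where b: "coeff r (nat q) = fps_to_fls (fps_of_poly b) * fls_X_inv ^ pole_order (nat q)"
    using lead_coeff_R[OF r(1) \<open>r \<noteq> 0\<close>] by auto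
  have "a \<ge> - int (pole_order (nat q))"
  proof (rule ccontr)
    assume "\<not> ?thesis"
    then have "c = 0" using co unfolding b by (simp add: fls_X_inv_power_times_conv_shift)
    with r(3) show False by simp
  qed
  then have "A * a \<ge> A * (- int (pole_order (nat q)))"
    using \<open>A \<ge> 0\<close> by (rule mult_left_mono)
  moreover define i j l where "i = nat q mod d" and "j = nat q div d mod m" and "l = nat q div (d * m)"
  have "nat q = i + d * j + d * m * l" unfolding i_def j_def l_def by (rule digits[symmetric])
  then have "q = int i + int d * int j + int (d * m) * int l"
    using q by (metis int_nat_eq of_nat_add of_nat_mult)
  then have "B * q = B * int i + (int d * B) * int j + (int (d * m) * B) * int l"
    by (simp add: algebra_simps)
  then have "A * (- int (pole_order (nat q))) + B * q = B * int i + H * int j + Z * int l"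
    unfolding y z by (simp add: pole_order_def j_def[symmetric] l_def[symmetric] algebra_simps)
  moreover have "H * int j \<ge> 0" "Z * int l \<ge> 0" using assms by auto
  moreover have "q mod int d = int i" using q by (simp add: i_def zmod_int)
  ultimately show ?thesis by simp
qed

end

locale LND_on_image = double_danielewski n e d m f g
  for n e d m and f g :: "nat \<Rightarrow> 'k::field_char_0 poly" +
  fixes D :: "'k fls poly \<Rightarrow> 'k fls poly"
  assumes D_closed: "r \<in> range eval_R \<Longrightarrow> D r \<in> range eval_R"
    and D_add: "r \<in> range eval_R \<Longrightarrow> t \<in> range eval_R \<Longrightarrow> D (r + t) = D r + D t"
    and D_mult: "r \<in> range eval_R \<Longrightarrow> t \<in> range eval_R \<Longrightarrow> D (r * t) = D r * t + r * D t"
    and D_const: "D (constK c) = 0"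
    and D_nilpotent: "r \<in> range eval_R \<Longrightarrow> \<exists>N. (D ^^ N) r = 0"
    and D_nonzero: "\<exists>r\<in>range eval_R. D r \<noteq> 0"
begin

text \<open>
  The derivation $u\,\partial_x + v\,\partial_s$ of $k((x))[s]$ with the values $u = Dx$ and $v = Ds$.
\<close>

definition E :: "'k fls poly \<Rightarrow> 'k fls poly" where
  "E r = D xK * ddx r + D sK * pderiv r"

lemma E_add: "E (r + t) = E r + E t"
  by (simp add: E_def ddx_add pderiv_add algebra_simps)

lemma E_mult: "E (r * t) = E r * t + r * E t"
  by (simp add: E_def ddx_mult pderiv_mult algebra_simps)

lemma K_subalgebra_D_eq_E: "K_subalgebra {r \<in> RR. D r = E r}"
proof -
  interpret K_subalgebra RR by (rule K_subalgebra_RR)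
  show ?thesis
  proof
    show "constK c \<in> {r \<in> RR. D r = E r}" for c
      using const_mem by (simp add: E_def ddx_simps pderiv_pCons D_const)
    show "xK \<in> {r \<in> RR. D r = E r}"
      using x_mem by (simp add: E_def ddx_simps pderiv_pCons)
  qed (auto simp: add_mem mult_mem D_add E_add D_mult E_mult)
qed

lemma D_eq_E_cancel_x:
  assumes "r \<in> RR" "xK ^ k * r \<in> {r \<in> RR. D r = E r}"
  shows "r \<in> {r \<in> RR. D r = E r}"
proof -
  interpret K_subalgebra "{r \<in> RR. D r = E r}" by (rule K_subalgebra_D_eq_E)
  have xk: "xK ^ k \<in> RR" "D (xK ^ k) = E (xK ^ k)"
    using power_mem[OF x_mem, of k] by auto
  have "D (xK ^ k) * r + xK ^ k * D r = E (xK ^ k) * r + xK ^ k * E r"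
    using assms(2) D_mult[OF xk(1) assms(1)] by (simp add: E_mult)
  then have "xK ^ k * D r = xK ^ k * E r" using xk(2) by simp
  then show ?thesis using assms(1) by simp
qed

text \<open>
  Both sides are derivations that agree on $k$, $x$ and $s$. Since $x^n y$ and
  $x^e z$ are polynomials in elements already treated, and $x$ is not a zero divisor, they agree
  on $y$ and $z$ too.
\<close>

lemma D_eq_E: assumes "r \<in> RR" shows "D r = E r"
proof -
  interpret K_subalgebra "{r \<in> RR. D r = E r}" by (rule K_subalgebra_D_eq_E)
  have s: "sK \<in> {r \<in> RR. D r = E r}"
    using RR_gens by (simp add: E_def ddx_simps pderiv_pCons)
  have y: "yK \<in> {r \<in> RR. D r = E r}"
    using D_eq_E_cancel_x[of yK n] RR_gens monic_at_mem[OF s] unfolding x_y PK_def by blast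
  have z: "zK \<in> {r \<in> RR. D r = E r}"
    using D_eq_E_cancel_x[of zK e] RR_gens diff_mem[OF monic_at_mem[OF y] s]
    unfolding x_z QK_def by blast
  show ?thesis using eval3_mem[OF y z] assms by auto
qed

text \<open>
  The factor $xs$ turns both partial derivatives into the Euler operators $x\partial_x$ and
  $s\partial_s$, which only multiply the coefficient of $x^a s^q$ by $a$ and by $q$.
\<close>

lemma xs_D: assumes "r \<in> RR"
  shows "xK * (sK * D r) = (sK * D xK) * (xK * ddx r) + (xK * D sK) * (sK * pderiv r)"
  unfolding D_eq_E[OF assms] E_def by (simp only: algebra_simps)

lemma D_x_eq_0: "D xK = 0" and degree_D_s: "degree (D sK) = 0"
proof -
  define u v where "u = sK * D xK" and "v = xK * D sK"
  have "D xK \<noteq> 0 \<or> D sK \<noteq> 0"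
    using D_nonzero D_eq_E unfolding E_def by auto
  then have "u \<noteq> 0 \<or> v \<noteq> 0" by (auto simp: u_def v_def)
  then obtain M p' \<alpha> \<beta> where u: "leading_term u M p' \<alpha>" and v: "leading_term v M p' \<beta>"
    and nz: "\<alpha> \<noteq> 0 \<or> \<beta> \<noteq> 0" by (rule common_leading_term)
  \<comment> \<open>The factor $xs$ in \<open>xs_D\<close> accounts for the two subtractions of $1$.\<close>
  define \<delta> p where "\<delta> = M - 1" and "p = p' - 1"
  define L where "L q a = \<alpha> * of_int a + \<beta> * of_int q" for q a :: int
  have step: "leading_term (D r) (q + \<delta>) (a + p) (L q a * c)"
    if "r \<in> RR" "leading_term r q a c" for r q a c
  proof -
    have "leading_term (xK * (sK * D r)) (M + q) (p' + a) (\<alpha> * (of_int a * c) + \<beta> * (of_int q * c))"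
      unfolding xs_D[OF that(1)] u_def[symmetric] v_def[symmetric]
      using that(2) u v
      by (intro leading_term_add leading_term_mult leading_term_x_ddx leading_term_s_pderiv)
    moreover have "M + q = (q + \<delta>) + 1" "p' + a = (a + p) + 1"
      "\<alpha> * (of_int a * c) + \<beta> * (of_int q * c) = L q a * c"
      by (simp_all add: \<delta>_def p_def L_def algebra_simps)
    ultimately show ?thesis by (simp only: leading_term_xK_iff leading_term_sK_iff)
  qed
  define lam where "lam = L \<delta> p"
  have iter: "(D ^^ k) r \<in> RR \<and> leading_term ((D ^^ k) r) (q + int k * \<delta>) (a + int k * p)
      ((\<Prod>i<k. L q a + of_nat i * lam) * c)"
    if "r \<in> RR" "leading_term r q a c" for r q a c k
  proof (induction k)
    case 0
    then show ?case using that by simp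
  next
    case (Suc k)
    have L: "L (q + int k * \<delta>) (a + int k * p) = L q a + of_nat k * lam"
      by (simp add: L_def lam_def algebra_simps)
    have "leading_term (D ((D ^^ k) r)) (q + int k * \<delta> + \<delta>) (a + int k * p + p)
        ((L q a + of_nat k * lam) * ((\<Prod>i<k. L q a + of_nat i * lam) * c))"
      using step[of "(D ^^ k) r"] Suc.IH unfolding L[symmetric] by blast
    moreover have "q + int k * \<delta> + \<delta> = q + int (Suc k) * \<delta>" "a + int k * p + p = a + int (Suc k) * p"
      by (simp_all add: algebra_simps)
    moreover have "(L q a + of_nat k * lam) * ((\<Prod>i<k. L q a + of_nat i * lam) * c) =
        (\<Prod>i<Suc k. L q a + of_nat i * lam) * c"
      by simp
    ultimately show ?case using D_closed Suc.IH by (simp only: funpow.simps o_apply)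
  qed
  \<comment> \<open>If no factor vanished, the leading coefficient of $D^N r$ would never vanish.\<close>
  have nil: "\<exists>k::nat. L q a = - of_nat k * lam"
    if r: "r \<in> RR" "leading_term r q a c" "c \<noteq> 0" for r q a c
  proof -
    obtain N where "(D ^^ N) r = 0" using D_nilpotent[OF r(1)] by blast
    then have "(\<Prod>i<N. L q a + of_nat i * lam) * c = 0"
      using iter[OF r(1,2), of N] by (simp add: leading_term_def)
    then obtain i where "L q a + of_nat i * lam = 0" using r(3) by auto
    then show ?thesis by (auto simp: eq_neg_iff_add_eq_0)
  qed
  have lx: "leading_term xK 0 1 1" and ls: "leading_term (sK :: 'k fls poly) 1 0 1"
    by (auto simp: leading_term_def bicoeff_def coeff_pCons split: nat.split)
  have ly: "leading_term yK (int d) (- int n) 1"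
    using leading_term_of_lead_coeff[OF degree_yK(2)] by (simp add: degree_yK(1))
  have lz: "leading_term zK (int (d * m)) (- int (n * m + e)) 1"
    using leading_term_of_lead_coeff[OF degree_zK(2)] by (simp add: degree_zK(1))
  \<comment> \<open>Up to the factor $-\lambda$ the weights of $x, s, y, z$ are natural numbers.\<close>
  obtain A where A: "\<alpha> = - of_nat A * lam"
    using nil[OF RR_gens(1) lx] by (auto simp: L_def)
  obtain B where B: "\<beta> = - of_nat B * lam"
    using nil[OF RR_gens(2) ls] by (auto simp: L_def)
  have lam: "lam \<noteq> 0" using nz A B by auto
  have L: "L q a = - of_int (int A * a + int B * q) * lam" for q a
    by (simp add: L_def A B algebra_simps)
  have weight: "int A * a + int B * q = k" if "L q a = - of_int k * lam" for q a k
  proof -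
    have "of_int (int A * a + int B * q) * lam = of_int k * lam"
      using that unfolding L mult_minus_left neg_equal_iff_equal .
    then show ?thesis unfolding mult_right_cancel[OF lam] of_int_eq_iff .
  qed
  obtain H where "L (int d) (- int n) = - of_nat H * lam" using nil[OF RR_gens(3) ly] by auto
  then have H: "int A * (- int n) + int B * int d = int H" by (intro weight) simp
  obtain Z where "L (int (d * m)) (- int (n * m + e)) = - of_nat Z * lam"
    using nil[OF RR_gens(4) lz] by auto
  then have Z: "int A * (- int (n * m + e)) + int B * int (d * m) = int Z"
    by (intro weight) simp
  have Hy: "int d * int B = int H + int n * int A" using H by (simp add: algebra_simps)
  have Hz: "int (d * m) * int B = int Z + int (n * m + e) * int A" using Z by (simp add: algebra_simps)
  have minus1: "int A * p + int B * \<delta> = - 1"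
    by (rule weight) (simp add: lam_def)
  \<comment> \<open>A leading term with non-zero weight is mapped to a true leading term, of weight one less.\<close>
  have image: "int B * ((q + \<delta>) mod int d) \<le> int A * a + int B * q - 1"
    if "r \<in> RR" "leading_term r q a 1" "int A * a + int B * q \<noteq> 0" for r q a
  proof -
    have "L q a * 1 \<noteq> 0" using that(3) lam unfolding L by (metis mult_cancel_right1 mult_eq_0_iff neg_equal_0_iff_equal of_int_eq_0_iff)
    from weight_bound[OF D_closed[OF that(1)] step[OF that(1,2)] this _ _ _ Hy Hz]
    have "int B * ((q + \<delta>) mod int d) \<le> int A * (a + p) + int B * (q + \<delta>)" by simp
    then show ?thesis using minus1 by (simp add: algebra_simps)
  qed
  have "A = 0"
  proof (rule ccontr)
    assume "A \<noteq> 0"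
    then have "int A > 0" by simp
    have "int B * (\<delta> mod int d) \<le> int A - 1"
      using image[OF RR_gens(1) lx] \<open>A \<noteq> 0\<close> by simp
    moreover have "int B * ((1 + \<delta>) mod int d) \<le> int B - 1"
    proof -
      have "int n * int A > 0" using n \<open>A \<noteq> 0\<close> by simp
      then have "B \<noteq> 0" using Hy by (cases "B = 0") auto
      then show ?thesis using image[OF RR_gens(2) ls] by simp
    qed
    moreover have "int B * ((int d + \<delta>) mod int d) \<le> int H - 1" if "int H > 0"
      using image[OF RR_gens(3) ly] that unfolding H by simp
    ultimately show False
      by (rule weights_inconsistent[OF n ne d m \<open>int A > 0\<close> of_nat_0_le_iff of_nat_0_le_iff
            of_nat_0_le_iff Hy Hz])
  qed
  then have "int B * (- \<delta>) = 1" using minus1 by simp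
  then have "int B = 1 \<and> - \<delta> = 1 \<or> int B = - 1 \<and> - \<delta> = - 1"
    by (simp only: zmult_eq_1_iff)
  then have "\<delta> = - 1" by linarith
  then have M: "M = 0" by (simp add: \<delta>_def)
  \<comment> \<open>$M = 0$ says that $s\,Dx$ and $x\,Ds$ have degree at most $0$ in $s$.\<close>
  have "coeff (D xK) i = 0" for i
  proof -
    have "coeff u (Suc i) = 0"
      using leading_term_degree[OF u] M by (simp add: coeff_eq_0)
    then show ?thesis by (simp add: u_def)
  qed
  then show "D xK = 0" by (simp add: poly_eq_iff)
  have "degree v = degree (D sK)" by (simp add: v_def)
  then show "degree (D sK) = 0" using leading_term_degree[OF v] M by simp
qed

lemma D_eq: "r \<in> RR \<Longrightarrow> D r = D sK * pderiv r"
  using D_eq_E by (simp add: E_def D_x_eq_0)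

lemma D_s_nonzero: "D sK \<noteq> 0"
  using D_nonzero D_eq by auto

lemma kernel_D_squared:
  assumes "r \<in> RR" "D (D r) = 0"
  shows "degree r \<le> 1"
proof -
  obtain v where v: "D sK = [:v:]" using degree_D_s by (metis degree_eq_zeroE)
  have "D (D r) = D sK * pderiv (D sK * pderiv r)"
    using D_eq[OF D_closed[OF assms(1)]] D_eq[OF assms(1)] by simp
  also have "\<dots> = D sK * (D sK * pderiv (pderiv r))"
    by (simp add: v pderiv_mult pderiv_pCons pderiv_smult)
  finally have "pderiv (pderiv r) = 0" using assms(2) D_s_nonzero by simp
  then have "degree (pderiv r) = 0" by (simp add: pderiv_eq_0_iff)
  then show ?thesis by (simp add: degree_pderiv)
qed

end

section \<open>Fractions and affine modifications\<close>

lemma cross_mult_mult: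
  fixes a b c d :: "'a::idom"
  shows "a * b' = a' * b \<Longrightarrow> c * d' = c' * d \<Longrightarrow> a' * c' * (b * d) = a * c * (b' * d')"
proof -
  assume eq: "a * b' = a' * b" "c * d' = c' * d"
  have "a' * c' * (b * d) = (a' * b) * (c' * d)" by (simp add: mult_ac)
  also have "\<dots> = (a * b') * (c * d')" by (simp only: eq)
  finally show ?thesis by (simp add: mult_ac)
qed

lemma cross_mult_add:
  fixes a b c d :: "'a::idom"
  shows "a * b' = a' * b \<Longrightarrow> c * d' = c' * d \<Longrightarrow>
    (a' * d' + c' * b') * (b * d) = (a * d + c * b) * (b' * d')"
proof -
  assume eq: "a * b' = a' * b" "c * d' = c' * d"
  have "(a' * d' + c' * b') * (b * d) = (a' * b) * (d' * d) + (c' * d) * (b' * b)"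
    by (simp add: algebra_simps)
  also have "\<dots> = (a * b') * (d' * d) + (c * d') * (b' * b)"
    by (simp only: eq)
  finally show ?thesis by (simp add: algebra_simps)
qed

text \<open>
  A commutative ring with an embedding into an integral domain. Identities and
  cancellation in \<open>A\<close> are checked in the domain, where the simplifier can normalise them.
\<close>

locale embedded_ring = cring A for A :: "'a ring" (structure) +
  fixes h :: "'a \<Rightarrow> 'c::idom"
  assumes h_one: "h \<one> = 1"
    and h_add: "a \<in> carrier A \<Longrightarrow> b \<in> carrier A \<Longrightarrow> h (a \<oplus> b) = h a + h b"
    and h_mult: "a \<in> carrier A \<Longrightarrow> b \<in> carrier A \<Longrightarrow> h (a \<otimes> b) = h a * h b"
    and h_inj: "inj_on h (carrier A)"
begin

lemma h_zero: "h \<zero> = 0"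
  using h_add[of \<zero> \<zero>] by (simp only: zero_closed l_zero add_cancel_right_right)

lemma h_minus: "a \<in> carrier A \<Longrightarrow> h (\<ominus> a) = - h a"
  using h_add[of a "\<ominus> a"] by (simp add: r_neg h_zero eq_neg_iff_add_eq_0 add.commute)

lemmas h_simps = h_one h_zero h_add h_mult h_minus

lemma h_eq_iff: "a \<in> carrier A \<Longrightarrow> b \<in> carrier A \<Longrightarrow> h a = h b \<longleftrightarrow> a = b"
  using h_inj by (auto dest: inj_onD)

lemma h_eq_0_iff: "a \<in> carrier A \<Longrightarrow> h a = 0 \<longleftrightarrow> a = \<zero>"
  using h_eq_iff[of a \<zero>] by (simp add: h_zero)

lemma embedded_domain: "domain A"
proof
  show "\<one> \<noteq> \<zero>" using h_one h_zero by auto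
  show "a = \<zero> \<or> b = \<zero>" if "a \<otimes> b = \<zero>" "a \<in> carrier A" "b \<in> carrier A" for a b
    using that h_mult[of a b] by (auto simp: h_zero h_eq_0_iff)
qed

abbreviation "denoms \<equiv> carrier A - {\<zero>}"

lemma denoms_mult: "b \<in> denoms \<Longrightarrow> d \<in> denoms \<Longrightarrow> b \<otimes> d \<in> denoms"
  using domain.integral[OF embedded_domain, of b d] by auto

lemma h_denom: "b \<in> denoms \<Longrightarrow> h b \<noteq> 0"
  by (simp add: h_eq_0_iff)

lemma one_denom: "\<one> \<in> denoms"
  using h_one h_zero by auto

lemma mem_frac_rel_iff: "((a, b), (c, d)) \<in> frac_rel A \<longleftrightarrow>
    a \<in> carrier A \<and> b \<in> denoms \<and> c \<in> carrier A \<and> d \<in> denoms \<and> h a * h d = h c * h b"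
  by (auto simp: frac_rel_def h_eq_iff simp flip: h_mult)

lemma equiv_frac_rel: "equiv (carrier A \<times> denoms) (frac_rel A)"
proof (rule equivI)
  show "frac_rel A \<subseteq> (carrier A \<times> denoms) \<times> (carrier A \<times> denoms)"
    by (auto simp: frac_rel_def)
  show "refl_on (carrier A \<times> denoms) (frac_rel A)"
    by (auto simp: refl_on_def mem_frac_rel_iff)
  show "sym (frac_rel A)"
    by (auto simp: sym_def mem_frac_rel_iff)
  show "trans (frac_rel A)"
  proof (rule transI, clarify)
    fix a b c d a' b'
    assume 1: "((a, b), (c, d)) \<in> frac_rel A" and 2: "((c, d), (a', b')) \<in> frac_rel A"
    then have "h d \<noteq> 0" by (auto simp: mem_frac_rel_iff h_denom)
    have "h d * (h a * h b') = (h a * h d) * h b'" by simp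
    also have "\<dots> = (h c * h b') * h b" using 1 by (simp add: mem_frac_rel_iff)
    also have "\<dots> = h d * (h a' * h b)" using 2 by (simp add: mem_frac_rel_iff)
    finally show "((a, b), (a', b')) \<in> frac_rel A"
      using 1 2 \<open>h d \<noteq> 0\<close> by (simp add: mem_frac_rel_iff)
  qed
qed

lemma frac_eq_iff:
  assumes "a \<in> carrier A" "b \<in> denoms" "c \<in> carrier A" "d \<in> denoms"
  shows "frac A a b = frac A c d \<longleftrightarrow> h a * h d = h c * h b"
  using eq_equiv_class_iff[OF equiv_frac_rel, of "(a, b)" "(c, d)"] assms
  by (simp add: frac_def mem_frac_rel_iff)

lemma mem_frac_iff: "(c, d) \<in> frac A a b \<longleftrightarrow> ((a, b), (c, d)) \<in> frac_rel A"
  by (simp add: frac_def)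

text \<open>
  The operations of \<open>frac_field\<close> are unions over all representatives; if the result does not
  depend on the representatives, the union is the common value.
\<close>

lemma frac_op:
  assumes "a \<in> carrier A" "b \<in> denoms" "c \<in> carrier A" "d \<in> denoms"
    and "\<And>a' b' c' d'. ((a, b), (a', b')) \<in> frac_rel A \<Longrightarrow> ((c, d), (c', d')) \<in> frac_rel A \<Longrightarrow>
      G a' b' c' d' = G a b c d"
  shows "(\<Union>(a', b')\<in>frac A a b. \<Union>(c', d')\<in>frac A c d. G a' b' c' d') = G a b c d"
proof -
  have "(a, b) \<in> frac A a b" "(c, d) \<in> frac A c d"
    using assms by (simp_all add: mem_frac_iff mem_frac_rel_iff)
  moreover have "G a' b' c' d' = G a b c d"
    if "(a', b') \<in> frac A a b" "(c', d') \<in> frac A c d" for a' b' c' d'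
    using assms(5) that by (simp add: mem_frac_iff)
  ultimately show ?thesis by fast
qed

lemma frac_mult:
  assumes "a \<in> carrier A" "b \<in> denoms" "c \<in> carrier A" "d \<in> denoms"
  shows "frac A a b \<otimes>\<^bsub>frac_field A\<^esub> frac A c d = frac A (a \<otimes> c) (b \<otimes> d)"
proof -
  have "frac A (a' \<otimes> c') (b' \<otimes> d') = frac A (a \<otimes> c) (b \<otimes> d)"
    if "((a, b), (a', b')) \<in> frac_rel A" "((c, d), (c', d')) \<in> frac_rel A" for a' b' c' d'
  proof -
    have *: "a' \<in> carrier A" "b' \<in> denoms" "c' \<in> carrier A" "d' \<in> denoms"
      and eq: "h a * h b' = h a' * h b" "h c * h d' = h c' * h d"
      using that by (auto simp: mem_frac_rel_iff)
    note cross_mult_mult[OF eq]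
    then show ?thesis
      using * assms by (subst frac_eq_iff) (auto simp: h_mult domain.integral_iff[OF embedded_domain])
  qed
  then show ?thesis
    using frac_op[OF assms, of "\<lambda>a b c d. frac A (a \<otimes> c) (b \<otimes> d)"] by (simp add: frac_field_def)
qed

lemma frac_add:
  assumes "a \<in> carrier A" "b \<in> denoms" "c \<in> carrier A" "d \<in> denoms"
  shows "frac A a b \<oplus>\<^bsub>frac_field A\<^esub> frac A c d = frac A (a \<otimes> d \<oplus> c \<otimes> b) (b \<otimes> d)"
proof -
  have "frac A (a' \<otimes> d' \<oplus> c' \<otimes> b') (b' \<otimes> d') = frac A (a \<otimes> d \<oplus> c \<otimes> b) (b \<otimes> d)"
    if "((a, b), (a', b')) \<in> frac_rel A" "((c, d), (c', d')) \<in> frac_rel A" for a' b' c' d'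
  proof -
    have *: "a' \<in> carrier A" "b' \<in> denoms" "c' \<in> carrier A" "d' \<in> denoms"
      and eq: "h a * h b' = h a' * h b" "h c * h d' = h c' * h d"
      using that by (auto simp: mem_frac_rel_iff)
    note cross_mult_add[OF eq]
    then show ?thesis
      using * assms by (subst frac_eq_iff) (auto simp: h_mult h_add domain.integral_iff[OF embedded_domain])
  qed
  then show ?thesis
    using frac_op[OF assms, of "\<lambda>a b c d. frac A (a \<otimes> d \<oplus> c \<otimes> b) (b \<otimes> d)"]
    by (simp add: frac_field_def)
qed

lemma frac_carrier:
  "U \<in> carrier (frac_field A) \<longleftrightarrow> (\<exists>a b. a \<in> carrier A \<and> b \<in> denoms \<and> U = frac A a b)"
  by (auto simp: frac_field_def quotient_def frac_def)

lemma frac_zero: "\<zero>\<^bsub>frac_field A\<^esub> = frac A \<zero> \<one>"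
  by (simp add: frac_field_def)

lemma frac_one: "\<one>\<^bsub>frac_field A\<^esub> = frac A \<one> \<one>"
  by (simp add: frac_field_def)

text \<open>
  Negation is the unique additive inverse in the carrier, so uniqueness has to be shown along with
  the sum being zero.
\<close>

lemma frac_minus:
  assumes "a \<in> carrier A" "b \<in> denoms"
  shows "\<ominus>\<^bsub>frac_field A\<^esub> frac A a b = frac A (\<ominus> a) b"
proof -
  have sum: "frac A a b \<oplus>\<^bsub>frac_field A\<^esub> frac A c d = frac A \<zero> \<one> \<longleftrightarrow> frac A c d = frac A (\<ominus> a) b"
    if "c \<in> carrier A" "d \<in> denoms" for c d
    using assms that frac_eq_iff[OF _ denoms_mult[OF assms(2) that(2)] _ one_denom]
    by (simp add: frac_add frac_eq_iff h_simps eq_neg_iff_add_eq_0 add.commute)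
  have comm: "frac A c d \<oplus>\<^bsub>frac_field A\<^esub> frac A a b = frac A a b \<oplus>\<^bsub>frac_field A\<^esub> frac A c d"
    if "c \<in> carrier A" "d \<in> denoms" for c d
    using assms that by (simp add: frac_add a_comm m_comm)
  have "(THE U. U \<in> carrier (frac_field A) \<and> frac A a b \<oplus>\<^bsub>frac_field A\<^esub> U = \<zero>\<^bsub>frac_field A\<^esub> \<and>
      U \<oplus>\<^bsub>frac_field A\<^esub> frac A a b = \<zero>\<^bsub>frac_field A\<^esub>) = frac A (\<ominus> a) b"
  proof (rule the_equality, goal_cases)
    case 1
    then show ?case
      using assms sum[of "\<ominus> a" b] comm[of "\<ominus> a" b] by (auto simp: frac_carrier frac_zero)
  next
    case (2 U)
    then obtain c d where cd: "c \<in> carrier A" "d \<in> denoms" "U = frac A c d"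
      by (auto simp: frac_carrier)
    with 2 sum[OF cd(1,2)] show ?case by (simp add: frac_zero)
  qed
  then show ?thesis by (simp add: a_inv_def m_inv_def)
qed

end

lemma subalgebra_transfer:
  assumes A: "embedded_ring A hA" and R: "embedded_ring R hR"
    and sub: "hA ` carrier A \<subseteq> hR ` carrier R"
  obtains \<phi> where "\<phi> \<in> ring_hom A R" "\<And>a. a \<in> carrier A \<Longrightarrow> hR (\<phi> a) = hA a"
proof -
  interpret A: embedded_ring A hA by (rule A)
  interpret R: embedded_ring R hR by (rule R)
  define \<phi> where "\<phi> a = inv_into (carrier R) hR (hA a)" for a
  have \<phi>: "\<phi> a \<in> carrier R" "hR (\<phi> a) = hA a" if "a \<in> carrier A" for a
  proof -
    have "hA a \<in> hR ` carrier R" using sub that by auto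
    then show "\<phi> a \<in> carrier R" "hR (\<phi> a) = hA a"
      unfolding \<phi>_def by (rule inv_into_into, rule f_inv_into_f)
  qed
  have "\<phi> \<in> ring_hom A R"
  proof (rule ring_hom_memI)
    fix a b assume ab: "a \<in> carrier A" "b \<in> carrier A"
    then have "hR (\<phi> (a \<otimes>\<^bsub>A\<^esub> b)) = hR (\<phi> a \<otimes>\<^bsub>R\<^esub> \<phi> b)" "hR (\<phi> (a \<oplus>\<^bsub>A\<^esub> b)) = hR (\<phi> a \<oplus>\<^bsub>R\<^esub> \<phi> b)"
      by (simp_all add: \<phi> A.h_simps R.h_simps)
    then show "\<phi> (a \<otimes>\<^bsub>A\<^esub> b) = \<phi> a \<otimes>\<^bsub>R\<^esub> \<phi> b" "\<phi> (a \<oplus>\<^bsub>A\<^esub> b) = \<phi> a \<oplus>\<^bsub>R\<^esub> \<phi> b"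
      using ab by (simp_all only: R.h_eq_iff \<phi>(1) A.m_closed A.a_closed R.m_closed R.a_closed)
  next
    have "hR (\<phi> \<one>\<^bsub>A\<^esub>) = hR \<one>\<^bsub>R\<^esub>" by (simp add: \<phi> A.h_simps R.h_simps)
    then show "\<phi> \<one>\<^bsub>A\<^esub> = \<one>\<^bsub>R\<^esub>" by (simp only: R.h_eq_iff \<phi>(1) A.one_closed R.one_closed)
  qed (rule \<phi>)
  then show ?thesis using \<phi>(2) by (rule that)
qed

text \<open>
  The isomorphism sends the fraction $a/b$ to the element \<open>r\<close> of \<open>R\<close> with $b r = a$. It is handled as
  the relation \<open>val\<close>, which is single-valued in both directions because the embeddings are into
  an integral domain. Each fraction in $A[I/f]$ has such an \<open>r\<close>, since the $a$ with $a/f \in R$ form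
  an ideal that contains the generators of $I$; each \<open>r\<close> arises, since \<open>R\<close> is generated by $A$ and
  the quotients $a/f$ for these generators.
\<close>

lemma is_affine_modificationI:
  fixes A :: "'a ring" and R :: "'r ring" and hA :: "'a \<Rightarrow> 'c::idom" and hR :: "'r \<Rightarrow> 'c"
  assumes A: "embedded_ring A hA" and R: "embedded_ring R hR"
    and S: "S \<subseteq> carrier A" "f \<in> S" "f \<noteq> \<zero>\<^bsub>A\<^esub>"
    and \<phi>: "\<phi> \<in> ring_hom A R" "\<And>a. a \<in> carrier A \<Longrightarrow> hR (\<phi> a) = hA a"
    and quot: "\<And>a. a \<in> S \<Longrightarrow> \<exists>r\<in>carrier R. hA f * hR r = hA a"
    and gen: "\<And>T r. (\<And>a. a \<in> carrier A \<Longrightarrow> hA a \<in> T) \<Longrightarrow>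
      (\<And>a t. a \<in> S \<Longrightarrow> hA f * t = hA a \<Longrightarrow> t \<in> T) \<Longrightarrow>
      (\<And>t t'. t \<in> T \<Longrightarrow> t' \<in> T \<Longrightarrow> t + t' \<in> T) \<Longrightarrow>
      (\<And>t t'. t \<in> T \<Longrightarrow> t' \<in> T \<Longrightarrow> t * t' \<in> T) \<Longrightarrow> r \<in> carrier R \<Longrightarrow> hR r \<in> T"
  shows "is_affine_modification \<phi> R A f (Idl\<^bsub>A\<^esub> S)"
proof -
  interpret A: embedded_ring A hA by (rule A)
  interpret R: embedded_ring R hR by (rule R)
  have \<phi>_closed: "\<phi> a \<in> carrier R" if "a \<in> carrier A" for a
    using \<phi>(1) that by (rule ring_hom_closed)
  define I where "I = Idl\<^bsub>A\<^esub> S"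
  have I: "ideal I A" unfolding I_def by (rule A.genideal_ideal[OF S(1)])
  have SI: "S \<subseteq> I" unfolding I_def by (rule A.genideal_self[OF S(1)])
  have I_carrier: "I \<subseteq> carrier A" using ideal.axioms(1)[OF I] additive_subgroup.a_subset by blast
  have f: "f \<in> carrier A" "f \<in> carrier A - {\<zero>\<^bsub>A\<^esub>}" using S by auto
  define Y where "Y = {a \<in> carrier A. \<exists>r\<in>carrier R. hA f * hR r = hA a}"
  have "ideal Y A"
  proof (rule idealI)
    show "ring A" by (rule A.ring_axioms)
    show "subgroup Y (add_monoid A)"
    proof (rule A.add.subgroupI)
      show "Y \<subseteq> carrier A" by (auto simp: Y_def)
      have "f \<in> Y" using S f quot[OF S(2)] by (simp add: Y_def)
      then show "Y \<noteq> {}" by auto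
    next
      fix a assume "a \<in> Y"
      then obtain r where "a \<in> carrier A" "r \<in> carrier R" "hA f * hR r = hA a" by (auto simp: Y_def)
      then show "\<ominus>\<^bsub>A\<^esub> a \<in> Y"
        by (auto simp: Y_def A.h_simps R.h_simps intro!: bexI[of _ "\<ominus>\<^bsub>R\<^esub> r"])
    next
      fix a b assume "a \<in> Y" "b \<in> Y"
      then obtain r t where "a \<in> carrier A" "r \<in> carrier R" "hA f * hR r = hA a"
        "b \<in> carrier A" "t \<in> carrier R" "hA f * hR t = hA b" by (auto simp: Y_def)
      then show "a \<oplus>\<^bsub>A\<^esub> b \<in> Y"
        by (auto simp: Y_def A.h_simps R.h_simps distrib_left intro!: bexI[of _ "r \<oplus>\<^bsub>R\<^esub> t"])
    qed
  next
    fix a b assume "a \<in> Y" and b: "b \<in> carrier A"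
    then obtain r where "a \<in> carrier A" "r \<in> carrier R" "hA f * hR r = hA a" by (auto simp: Y_def)
    then have "hA f * hR (r \<otimes>\<^bsub>R\<^esub> \<phi> b) = hA (a \<otimes>\<^bsub>A\<^esub> b)" "r \<otimes>\<^bsub>R\<^esub> \<phi> b \<in> carrier R" "a \<in> carrier A"
      using b \<phi>_closed by (simp_all add: A.h_simps R.h_simps \<phi> flip: mult.assoc)
    then show "a \<otimes>\<^bsub>A\<^esub> b \<in> Y" using b unfolding Y_def by blast
    then show "b \<otimes>\<^bsub>A\<^esub> a \<in> Y" using b \<open>a \<in> carrier A\<close> by (simp add: A.m_comm)
  qed
  moreover have "S \<subseteq> Y" using quot S(1) by (auto simp: Y_def)
  ultimately have "I \<subseteq> Y" unfolding I_def by (rule A.genideal_minimal)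
  define Fr where "Fr = frac_field A"
  define U where "U = generate_ring Fr ({frac A a \<one>\<^bsub>A\<^esub> | a. a \<in> carrier A} \<union> {frac A a f | a. a \<in> I})"
  define val where "val u r \<longleftrightarrow> r \<in> carrier R \<and> (\<exists>a b. a \<in> carrier A \<and> b \<in> carrier A - {\<zero>\<^bsub>A\<^esub>} \<and>
      u = frac A a b \<and> hA b * hR r = hA a)" for u r
  have valI: "val u r" if "a \<in> carrier A" "b \<in> carrier A - {\<zero>\<^bsub>A\<^esub>}" "r \<in> carrier R" "u = frac A a b"
    "hA b * hR r = hA a" for a b u r
    using that unfolding val_def by blast
  have val_base: "val (frac A a \<one>\<^bsub>A\<^esub>) (\<phi> a)" if "a \<in> carrier A" for a
    using that A.one_denom \<phi>_closed \<phi>(2) A.h_one unfolding val_def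
    by (intro conjI exI[of _ a] exI[of _ "\<one>\<^bsub>A\<^esub>"]) auto
  have val_quot: "val (frac A a f) r" if "a \<in> carrier A" "r \<in> carrier R" "hA f * hR r = hA a" for a r
    using that f unfolding val_def by blast
  have val_mult: "val (u \<otimes>\<^bsub>Fr\<^esub> u') (r \<otimes>\<^bsub>R\<^esub> r')" if uu: "val u r" "val u' r'" for u u' r r'
  proof -
    obtain a b c d where *: "r \<in> carrier R" "a \<in> carrier A" "b \<in> carrier A - {\<zero>\<^bsub>A\<^esub>}"
      "r' \<in> carrier R" "c \<in> carrier A" "d \<in> carrier A - {\<zero>\<^bsub>A\<^esub>}"
      "u = frac A a b" "u' = frac A c d" "hA b * hR r = hA a" "hA d * hR r' = hA c"
      using uu unfolding val_def by blast
    have "hA (b \<otimes>\<^bsub>A\<^esub> d) * hR (r \<otimes>\<^bsub>R\<^esub> r') = hA (a \<otimes>\<^bsub>A\<^esub> c)"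
      using * by (simp add: A.h_simps R.h_simps mult_ac flip: *(9,10))
    moreover have "a \<otimes>\<^bsub>A\<^esub> c \<in> carrier A" "r \<otimes>\<^bsub>R\<^esub> r' \<in> carrier R" using * by simp_all
    moreover have "u \<otimes>\<^bsub>Fr\<^esub> u' = frac A (a \<otimes>\<^bsub>A\<^esub> c) (b \<otimes>\<^bsub>A\<^esub> d)"
      unfolding Fr_def *(7,8) using *(2,3,5,6) by (rule A.frac_mult)
    ultimately show ?thesis using A.denoms_mult[OF *(3,6)] by (intro valI)
  qed
  have val_add: "val (u \<oplus>\<^bsub>Fr\<^esub> u') (r \<oplus>\<^bsub>R\<^esub> r')" if uu: "val u r" "val u' r'" for u u' r r'
  proof -
    obtain a b c d where *: "r \<in> carrier R" "a \<in> carrier A" "b \<in> carrier A - {\<zero>\<^bsub>A\<^esub>}"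
      "r' \<in> carrier R" "c \<in> carrier A" "d \<in> carrier A - {\<zero>\<^bsub>A\<^esub>}"
      "u = frac A a b" "u' = frac A c d" "hA b * hR r = hA a" "hA d * hR r' = hA c"
      using uu unfolding val_def by blast
    have "hA (b \<otimes>\<^bsub>A\<^esub> d) * hR (r \<oplus>\<^bsub>R\<^esub> r') = hA (a \<otimes>\<^bsub>A\<^esub> d \<oplus>\<^bsub>A\<^esub> c \<otimes>\<^bsub>A\<^esub> b)"
      using * by (simp add: A.h_simps R.h_simps algebra_simps flip: *(9,10))
    moreover have "a \<otimes>\<^bsub>A\<^esub> d \<oplus>\<^bsub>A\<^esub> c \<otimes>\<^bsub>A\<^esub> b \<in> carrier A" "r \<oplus>\<^bsub>R\<^esub> r' \<in> carrier R" using * by simp_all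
    moreover have "u \<oplus>\<^bsub>Fr\<^esub> u' = frac A (a \<otimes>\<^bsub>A\<^esub> d \<oplus>\<^bsub>A\<^esub> c \<otimes>\<^bsub>A\<^esub> b) (b \<otimes>\<^bsub>A\<^esub> d)"
      unfolding Fr_def *(7,8) using *(2,3,5,6) by (rule A.frac_add)
    ultimately show ?thesis using A.denoms_mult[OF *(3,6)] by (intro valI)
  qed
  have val_minus: "val (\<ominus>\<^bsub>Fr\<^esub> u) (\<ominus>\<^bsub>R\<^esub> r)" if uu: "val u r" for u r
  proof -
    obtain a b where *: "r \<in> carrier R" "a \<in> carrier A" "b \<in> carrier A - {\<zero>\<^bsub>A\<^esub>}"
      "u = frac A a b" "hA b * hR r = hA a"
      using uu unfolding val_def by blast
    then have "hA b * hR (\<ominus>\<^bsub>R\<^esub> r) = hA (\<ominus>\<^bsub>A\<^esub> a)" "\<ominus>\<^bsub>A\<^esub> a \<in> carrier A" "\<ominus>\<^bsub>R\<^esub> r \<in> carrier R"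
      by (simp_all add: A.h_simps R.h_simps)
    moreover have "\<ominus>\<^bsub>Fr\<^esub> u = frac A (\<ominus>\<^bsub>A\<^esub> a) b"
      unfolding Fr_def *(4) using *(2,3) by (rule A.frac_minus)
    ultimately show ?thesis using *(3) by (intro valI)
  qed
  have val_iff: "u = u' \<longleftrightarrow> r = r'" if uu: "val u r" "val u' r'" for u u' r r'
  proof -
    obtain a b c d where *: "r \<in> carrier R" "a \<in> carrier A" "b \<in> carrier A - {\<zero>\<^bsub>A\<^esub>}"
      "r' \<in> carrier R" "c \<in> carrier A" "d \<in> carrier A - {\<zero>\<^bsub>A\<^esub>}"
      "u = frac A a b" "u' = frac A c d" "hA b * hR r = hA a" "hA d * hR r' = hA c"
      using uu unfolding val_def by blast
    have "u = u' \<longleftrightarrow> hA a * hA d = hA c * hA b"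
      using * by (simp add: A.frac_eq_iff)
    also have "\<dots> \<longleftrightarrow> (hA b * hA d) * hR r = (hA b * hA d) * hR r'"
      using *(9,10) by (simp add: mult_ac flip: *(9,10))
    also have "\<dots> \<longleftrightarrow> r = r'"
      using * A.h_denom[of b] A.h_denom[of d] by (simp add: R.h_eq_iff)
    finally show ?thesis .
  qed
  have val_ex: "\<exists>r. val u r" if "u \<in> U" for u
    using that unfolding U_def
  proof induction
    case one
    show ?case using val_base[OF A.one_closed] by (auto simp: Fr_def A.frac_one)
  next
    case (incl u)
    then consider a where "a \<in> carrier A" "u = frac A a \<one>\<^bsub>A\<^esub>" | a where "a \<in> I" "u = frac A a f"
      by blast
    then show ?case
    proof cases
      case 1
      then show ?thesis using val_base[OF 1(1)] by blast
    next
      case 2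
      then obtain r where "a \<in> carrier A" "r \<in> carrier R" "hA f * hR r = hA a"
        using \<open>I \<subseteq> Y\<close> unfolding Y_def by blast
      then show ?thesis using val_quot[of a r] 2(2) by blast
    qed
  next
    case (a_inv u)
    then obtain r where "val u r" by blast
    then show ?case using val_minus by blast
  next
    case (eng_add u u')
    then obtain r r' where "val u r" "val u' r'" by blast
    then show ?case using val_add by blast
  next
    case (eng_mult u u')
    then obtain r r' where "val u r" "val u' r'" by blast
    then show ?case using val_mult by blast
  qed
  define T where "T = {t. \<exists>u\<in>U. \<exists>r. val u r \<and> hR r = t}"
  have T: "hR r \<in> T" if "r \<in> carrier R" for r
  proof (rule gen)
    show "hA a \<in> T" if "a \<in> carrier A" for a
      using val_base[OF that] \<phi>(2)[OF that] that unfolding T_def U_def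
      by (blast intro: generate_ring.incl)
    show "t \<in> T" if a: "a \<in> S" and t: "hA f * t = hA a" for a t
    proof -
      obtain r where r: "r \<in> carrier R" "hA f * hR r = hA a" using quot[OF a] by blast
      then have "hR r = t" using t A.h_denom[OF f(2)] by (metis mult_left_cancel)
      moreover have "val (frac A a f) r" using val_quot r a S(1) by blast
      moreover have "frac A a f \<in> U" using a SI unfolding U_def by (blast intro: generate_ring.incl)
      ultimately show ?thesis unfolding T_def by blast
    qed
    show "t + t' \<in> T" if tt: "t \<in> T" "t' \<in> T" for t t'
    proof -
      obtain u r u' r' where *: "u \<in> U" "val u r" "hR r = t" "u' \<in> U" "val u' r'" "hR r' = t'"
        using tt unfolding T_def by blast
      then have "u \<oplus>\<^bsub>Fr\<^esub> u' \<in> U" unfolding U_def by (blast intro: generate_ring.eng_add)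
      moreover have "hR (r \<oplus>\<^bsub>R\<^esub> r') = t + t'" using * by (auto simp: val_def R.h_add)
      ultimately show ?thesis using val_add[OF *(2,5)] unfolding T_def by blast
    qed
    show "t * t' \<in> T" if tt: "t \<in> T" "t' \<in> T" for t t'
    proof -
      obtain u r u' r' where *: "u \<in> U" "val u r" "hR r = t" "u' \<in> U" "val u' r'" "hR r' = t'"
        using tt unfolding T_def by blast
      then have "u \<otimes>\<^bsub>Fr\<^esub> u' \<in> U" unfolding U_def by (blast intro: generate_ring.eng_mult)
      moreover have "hR (r \<otimes>\<^bsub>R\<^esub> r') = t * t'" using * by (auto simp: val_def R.h_mult)
      ultimately show ?thesis using val_mult[OF *(2,5)] unfolding T_def by blast
    qed
  qed (rule that)
  have val_surj: "\<exists>u\<in>U. val u r" if r: "r \<in> carrier R" for r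
  proof -
    obtain u r' where u: "u \<in> U" "val u r'" "hR r' = hR r" using T[OF r] unfolding T_def by blast
    then have "r' = r" using r by (simp add: val_def R.h_eq_iff)
    with u show ?thesis by blast
  qed
  define \<psi> where "\<psi> u = (THE r. val u r)" for u
  have \<psi>: "\<psi> u = r" if "val u r" for u r
    unfolding \<psi>_def using that val_iff[OF that] by (intro the_equality) blast+
  have \<psi>': "val u (\<psi> u)" if "u \<in> U" for u
    using val_ex[OF that] \<psi> by blast
  have AM: "affine_modification A I f = Fr\<lparr>carrier := U\<rparr>"
    by (simp add: affine_modification_def U_def Fr_def)
  have "\<psi> \<in> ring_iso (affine_modification A I f) R"
    unfolding AM
  proof (rule ring_iso_memI)
    show "\<psi> u \<in> carrier R" if "u \<in> carrier (Fr\<lparr>carrier := U\<rparr>)" for u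
      using \<psi>' that by (auto simp: val_def)
    show "\<psi> (u \<otimes>\<^bsub>Fr\<lparr>carrier := U\<rparr>\<^esub> u') = \<psi> u \<otimes>\<^bsub>R\<^esub> \<psi> u'"
      if "u \<in> carrier (Fr\<lparr>carrier := U\<rparr>)" "u' \<in> carrier (Fr\<lparr>carrier := U\<rparr>)" for u u'
      using \<psi>[OF val_mult[OF \<psi>' \<psi>']] that by simp
    show "\<psi> (u \<oplus>\<^bsub>Fr\<lparr>carrier := U\<rparr>\<^esub> u') = \<psi> u \<oplus>\<^bsub>R\<^esub> \<psi> u'"
      if "u \<in> carrier (Fr\<lparr>carrier := U\<rparr>)" "u' \<in> carrier (Fr\<lparr>carrier := U\<rparr>)" for u u'
      using \<psi>[OF val_add[OF \<psi>' \<psi>']] that by simp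
    have "\<phi> \<one>\<^bsub>A\<^esub> = \<one>\<^bsub>R\<^esub>" using \<phi>(1) by (rule ring_hom_one)
    then show "\<psi> \<one>\<^bsub>Fr\<lparr>carrier := U\<rparr>\<^esub> = \<one>\<^bsub>R\<^esub>"
      using \<psi>[OF val_base[OF A.one_closed]] by (simp add: Fr_def A.frac_one)
    have "inj_on \<psi> U"
    proof (rule inj_onI)
      fix u u' assume uu: "u \<in> U" "u' \<in> U" "\<psi> u = \<psi> u'"
      then show "u = u'" using val_iff[OF \<psi>'[OF uu(1)] \<psi>'[OF uu(2)]] by blast
    qed
    moreover have "\<psi> ` U = carrier R"
    proof
      show "\<psi> ` U \<subseteq> carrier R" using \<psi>' by (auto simp: val_def)
      show "carrier R \<subseteq> \<psi> ` U" using val_surj \<psi> by force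
    qed
    ultimately show "bij_betw \<psi> (carrier (Fr\<lparr>carrier := U\<rparr>)) (carrier R)"
      by (simp add: bij_betw_def)
  qed
  moreover have "\<forall>a\<in>carrier A. \<psi> (frac A a \<one>\<^bsub>A\<^esub>) = \<phi> a"
    using \<psi>[OF val_base] by blast
  ultimately show ?thesis
    unfolding is_affine_modification_def I_def[symmetric]
    using A.embedded_domain I SI S(2,3) by blast
qed

section \<open>Quotients of polynomial rings as rings of values\<close>

locale evaluated_quotient =
  fixes J :: "'k::field_char_0 poly3 set" and t u :: "'k fls poly"
  assumes J: "ideal J poly3_ring" and kernel: "eval3 t u p = 0 \<longleftrightarrow> p \<in> J"
begin

abbreviation "Q \<equiv> (poly3_ring :: 'k poly3 ring) Quot J"
abbreviation "cls p \<equiv> J +>\<^bsub>poly3_ring\<^esub> p"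
abbreviation "ev \<equiv> eval3 t u"

text \<open>
  The evaluation is constant on each coset, so its image there is a singleton.
\<close>

definition val :: "'k poly3 set \<Rightarrow> 'k fls poly" where
  "val U = the_elem (ev ` U)"

lemma ring_hom_cls: "cls \<in> ring_hom poly3_ring Q"
  using ideal.rcos_ring_hom[OF J] by simp

lemma cls_simps:
  "cls p \<otimes>\<^bsub>Q\<^esub> cls q = cls (p * q)" "cls p \<oplus>\<^bsub>Q\<^esub> cls q = cls (p + q)" "\<one>\<^bsub>Q\<^esub> = cls 1"
  using ring_hom_mult[OF ring_hom_cls, of p q] ring_hom_add[OF ring_hom_cls, of p q]
    ring_hom_one[OF ring_hom_cls] by simp_all

lemma carrier_Q: "carrier Q = range cls"
  by (auto simp: FactRing_def A_RCOSETS_def')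

lemma cls_fiber: "cls p = {r. ev r = ev p}"
proof
  show "cls p \<subseteq> {r. ev r = ev p}"
    using kernel by (auto simp: a_r_coset_def' comm_ring_map.map_add[OF comm_ring_map_eval3])
  show "{r. ev r = ev p} \<subseteq> cls p"
  proof
    fix r assume "r \<in> {r. ev r = ev p}"
    then have "r - p \<in> J"
      using kernel[of "r - p"] by (simp add: comm_ring_map.map_diff[OF comm_ring_map_eval3])
    then show "r \<in> cls p"
      by (auto simp: a_r_coset_def' intro!: bexI[of _ "r - p"])
  qed
qed

lemma val_cls: "val (cls p) = ev p"
proof -
  have "ev ` cls p = {ev p}" unfolding cls_fiber by auto
  then show ?thesis by (simp add: val_def)
qed

lemma cls_eq_iff: "cls p = cls q \<longleftrightarrow> ev p = ev q"
  unfolding cls_fiber by auto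

lemma embedded_val: "embedded_ring Q val"
proof -
  have "cring Q" by (rule ideal.quotient_is_cring[OF J cring_from_type_algebra])
  moreover have "inj_on val (carrier Q)"
    by (auto simp: carrier_Q inj_on_def val_cls cls_eq_iff)
  moreover have "val (U \<otimes>\<^bsub>Q\<^esub> V) = val U * val V \<and> val (U \<oplus>\<^bsub>Q\<^esub> V) = val U + val V"
    if "U \<in> carrier Q" "V \<in> carrier Q" for U V
    using that by (auto simp: carrier_Q cls_simps val_cls comm_ring_map.map_mult[OF comm_ring_map_eval3]
        comm_ring_map.map_add[OF comm_ring_map_eval3])
  moreover have "val \<one>\<^bsub>Q\<^esub> = 1"
    by (simp add: cls_simps val_cls comm_ring_map.map_one[OF comm_ring_map_eval3])
  ultimately show ?thesis
    by (intro embedded_ring.intro embedded_ring_axioms.intro) auto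
qed

lemma val_image: "val ` carrier Q = range ev"
  by (auto simp: carrier_Q val_cls image_image)

end

lemma eval2_s_pCons: "eval2 sK (pCons a p) = pCons (fps_to_fls (fps_of_poly a)) (eval2 sK p)"
  by (simp add: eval2_def comm_ring_map.eval_at_pCons[OF comm_ring_map_of_X] of_X_def)

lemma eval2_s_eq_0_iff: "eval2 sK p = 0 \<longleftrightarrow> p = 0"
proof (induction p)
  case 0
  show ?case by (simp add: comm_ring_map.map_zero[OF comm_ring_map_eval2])
next
  case (pCons a p)
  then show ?case unfolding eval2_s_pCons pCons_eq_0_iff
    by (metis fps_of_poly_0 fps_of_poly_eq_iff fps_to_fls_eq_0_iff)
qed

lemma embedded_eval2_s: "embedded_ring poly2_ring (eval2 (sK :: 'k::field_char_0 fls poly))"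
proof -
  have "inj (eval2 (sK :: 'k fls poly))"
  proof (rule injI)
    fix p q :: "'k poly2" assume "eval2 sK p = eval2 sK q"
    then have "eval2 sK (p - q) = 0" by (simp add: comm_ring_map.map_diff[OF comm_ring_map_eval2])
    then show "p = q" by (simp add: eval2_s_eq_0_iff)
  qed
  then show ?thesis
    by (intro embedded_ring.intro embedded_ring_axioms.intro cring_from_type_algebra)
      (simp_all add: comm_ring_map.map_simps[OF comm_ring_map_eval2])
qed

section \<open>The AL-invariant of R\<close>

context double_danielewski
begin

abbreviation "R \<equiv> R_alg n e d m f g"
abbreviation "B \<equiv> B_alg n d f"
abbreviation "cR \<equiv> R_class n e d m f g"
abbreviation "cB \<equiv> B_class n d f"

lemma evaluated_quotient_R: "evaluated_quotient (R_ideal n e d m f g) yK zK"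
proof (rule evaluated_quotient.intro)
  show "ideal (R_ideal n e d m f g) poly3_ring"
    unfolding R_ideal_def by (intro cring.cgenideal_ideal cring_from_type_algebra) simp
qed (rule kernel_R)

lemma evaluated_quotient_B: "evaluated_quotient (B_ideal n d f) sK yK"
proof (rule evaluated_quotient.intro)
  show "ideal (B_ideal n d f) poly3_ring"
    unfolding B_ideal_def by (intro cring.cgenideal_ideal cring_from_type_algebra) simp
qed (rule kernel_B)

definition val_R :: "'k poly3 set \<Rightarrow> 'k fls poly" where
  "val_R = evaluated_quotient.val yK zK"

definition val_B :: "'k poly3 set \<Rightarrow> 'k fls poly" where
  "val_B = evaluated_quotient.val sK yK"

lemma embedded_R: "embedded_ring R val_R"
  unfolding R_alg_def val_R_def by (rule evaluated_quotient.embedded_val[OF evaluated_quotient_R])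

lemma embedded_B: "embedded_ring B val_B"
  unfolding B_alg_def val_B_def by (rule evaluated_quotient.embedded_val[OF evaluated_quotient_B])

lemma val_cR: "val_R (cR p) = eval_R p" and cR_closed: "cR p \<in> carrier R"
  and val_R_image: "val_R ` carrier R = RR"
  using evaluated_quotient.val_cls[OF evaluated_quotient_R] evaluated_quotient.carrier_Q[OF evaluated_quotient_R]
    evaluated_quotient.val_image[OF evaluated_quotient_R]
  by (simp_all add: R_alg_def val_R_def R_class_def)

lemma val_cB: "val_B (cB p) = eval_B p" and cB_closed: "cB p \<in> carrier B"
  and val_B_image: "val_B ` carrier B = range eval_B"
  using evaluated_quotient.val_cls[OF evaluated_quotient_B] evaluated_quotient.carrier_Q[OF evaluated_quotient_B]
    evaluated_quotient.val_image[OF evaluated_quotient_B]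
  by (simp_all add: B_alg_def val_B_def B_class_def)

interpretation R: embedded_ring R val_R by (rule embedded_R)
interpretation RR: K_subalgebra RR by (rule K_subalgebra_RR)

definition of_val :: "'k fls poly \<Rightarrow> 'k poly3 set" where
  "of_val r = inv_into (carrier R) val_R r"

lemma of_val:
  assumes "r \<in> RR" shows "of_val r \<in> carrier R" "val_R (of_val r) = r"
  using assms inv_into_into[of r val_R "carrier R"] f_inv_into_f[of r val_R "carrier R"]
  unfolding of_val_def val_R_image by blast+

lemma of_val_val: "U \<in> carrier R \<Longrightarrow> of_val (val_R U) = U"
  using R.h_eq_iff of_val val_R_image by (metis imageI)

lemma val_R_mem: "U \<in> carrier R \<Longrightarrow> val_R U \<in> RR"
  using val_R_image by blast

text \<open>
  The derivation $x^{nm+e}\partial_s$; the power of $x$ clears the denominators of $\partial_s y$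
  and $\partial_s z$.
\<close>

definition \<Delta> :: "'k fls poly \<Rightarrow> 'k fls poly" where
  "\<Delta> r = xK ^ (n * m + e) * pderiv r"

lemma K_subalgebra_pderiv: "K_subalgebra {r \<in> RR. xK ^ k * pderiv r \<in> RR}"
proof
  fix a b
  assume a: "a \<in> {r \<in> RR. xK ^ k * pderiv r \<in> RR}" and b: "b \<in> {r \<in> RR. xK ^ k * pderiv r \<in> RR}"
  have "xK ^ k * pderiv (a + b) = xK ^ k * pderiv a + xK ^ k * pderiv b"
    by (simp only: pderiv_add distrib_left)
  then show "a + b \<in> {r \<in> RR. xK ^ k * pderiv r \<in> RR}"
    using a b by (simp add: RR.add_mem)
  have "xK ^ k * pderiv (a * b) = (xK ^ k * pderiv a) * b + a * (xK ^ k * pderiv b)"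
    by (simp only: pderiv_mult algebra_simps)
  moreover have "(xK ^ k * pderiv a) * b \<in> RR" "a * (xK ^ k * pderiv b) \<in> RR"
    using a b by (auto intro: RR.mult_mem)
  ultimately show "a * b \<in> {r \<in> RR. xK ^ k * pderiv r \<in> RR}"
    using a b by (simp only: mem_Collect_eq RR.mult_mem RR.add_mem)
qed (simp_all add: RR.const_mem RR.x_mem RR.zero_mem pderiv_pCons)

lemma pderiv_x_power_mult: "pderiv (xK ^ k * r) = xK ^ k * pderiv (r :: 'k fls poly)"
proof -
  have x: "pderiv (xK ^ k :: 'k fls poly) = 0"
    by (induction k) (simp_all add: pderiv_mult pderiv_smult pderiv_pCons)
  show ?thesis by (simp only: pderiv_mult x mult_zero_left mult_zero_right add_0_right)
qed

text \<open>
  Starting from $\partial_s s = 1$, each division by a power of $x$ raises the power of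
  $x$ that is needed in front of $\partial_s$: none for $P(x,s)$, $x^n$ for $y$ and for $Q(x,y) - s$,
  and so $x^{n+e}$ for $z$, where $n + e \le nm + e$.
\<close>

lemma \<Delta>_closed: assumes "r \<in> RR" shows "\<Delta> r \<in> RR"
proof -
  define N where "N k = {r \<in> RR. xK ^ k * pderiv r \<in> RR}" for k
  have N: "K_subalgebra (N k)" for k unfolding N_def by (rule K_subalgebra_pderiv)
  have shift: "r \<in> N k" if "r \<in> RR" "xK ^ l * r \<in> N j" "k = l + j + i" for r k l j i
  proof -
    have "xK ^ k * pderiv r = xK ^ i * (xK ^ j * pderiv (xK ^ l * r))"
      unfolding pderiv_x_power_mult by (simp only: that(3) power_add mult_ac)
    also have "\<dots> \<in> RR" using that(2) unfolding N_def by (blast intro: RR.mult_mem RR.power_mem RR.x_mem)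
    finally show ?thesis using that(1) by (simp add: N_def)
  qed
  have s: "sK \<in> N k" for k
    using RR_gens RR.power_mem[OF RR.x_mem, of k] by (simp add: N_def pderiv_pCons)
  have "PK \<in> N 0" unfolding PK_def by (rule K_subalgebra.monic_at_mem[OF N s])
  then have y: "yK \<in> N (n + i)" for i
    using shift[of yK n 0 "n + i" i] RR_gens by (simp add: x_y)
  have "QK - sK \<in> N n"
    unfolding QK_def
    by (intro K_subalgebra.diff_mem[OF N] K_subalgebra.monic_at_mem[OF N] s y[of 0, simplified])
  moreover have nm: "n * m + e = e + n + (n * m - n)" using n m by (simp add: le_add_diff_inverse)
  ultimately have z: "zK \<in> N (n * m + e)"
    using shift[of zK e n "n * m + e" "n * m - n"] RR_gens by (simp only: x_z)
  have "yK \<in> N (n * m + e)" using y[of "n * m - n + e"] nm by (simp add: add_ac)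
  then have "r \<in> N (n * m + e)"
    using K_subalgebra.eval3_mem[OF N _ z] assms by blast
  then show ?thesis by (simp add: N_def \<Delta>_def)
qed

lemma \<Delta>_funpow_eq_0: "degree r < N \<Longrightarrow> (\<Delta> ^^ N) r = 0"
proof (induction N arbitrary: r)
  case (Suc N)
  have "degree (xK ^ k :: 'k fls poly) = 0" for k
    by (induction k) (simp_all add: degree_mult_eq)
  then have "degree (\<Delta> r) \<le> degree (pderiv r)"
    unfolding \<Delta>_def using degree_mult_le[of "xK ^ (n * m + e)" "pderiv r"] by simp
  then have deg: "degree (\<Delta> r) \<le> degree r - 1" by (simp add: degree_pderiv)
  show ?case
  proof (cases "degree (\<Delta> r) < N")
    case True
    then show ?thesis using Suc.IH[of "\<Delta> r"] by (simp add: funpow_Suc_right del: funpow.simps)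
  next
    case False
    then have "N = 0" "degree r = 0" using deg Suc.prems by auto
    then have "pderiv r = 0" by (simp add: pderiv_eq_0_iff)
    then show ?thesis using \<open>N = 0\<close> by (simp add: \<Delta>_def)
  qed
qed simp

definition D0 :: "'k poly3 set \<Rightarrow> 'k poly3 set" where
  "D0 U = of_val (\<Delta> (val_R U))"

lemma D0: "U \<in> carrier R \<Longrightarrow> D0 U \<in> carrier R" "U \<in> carrier R \<Longrightarrow> val_R (D0 U) = \<Delta> (val_R U)"
  by (simp_all add: D0_def of_val \<Delta>_closed val_R_mem)

lemma nonzero_LND_D0: "nonzero_LND (cR \<circ> const3) R D0"
  unfolding nonzero_LND_def k_derivation_def locally_nilpotent_def
proof (intro conjI ballI allI funcsetI)
  fix a assume a: "a \<in> carrier R"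
  show "D0 a \<in> carrier R" using a by (rule D0)
  have "(D0 ^^ N) a \<in> carrier R \<and> val_R ((D0 ^^ N) a) = (\<Delta> ^^ N) (val_R a)" for N
    using a D0 by (induction N) auto
  then have "val_R ((D0 ^^ Suc (degree (val_R a))) a) = val_R \<zero>\<^bsub>R\<^esub>"
    "(D0 ^^ Suc (degree (val_R a))) a \<in> carrier R"
    using \<Delta>_funpow_eq_0[of "val_R a" "Suc (degree (val_R a))"] by (simp_all only: R.h_zero lessI)
  then show "\<exists>N. (D0 ^^ N) a = \<zero>\<^bsub>R\<^esub>" by (metis R.h_eq_iff R.zero_closed)
  fix b assume b: "b \<in> carrier R"
  have "val_R (D0 (a \<oplus>\<^bsub>R\<^esub> b)) = val_R (D0 a \<oplus>\<^bsub>R\<^esub> D0 b)"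
    using a b by (simp add: D0 R.h_simps) (simp add: \<Delta>_def pderiv_add algebra_simps)
  then show "D0 (a \<oplus>\<^bsub>R\<^esub> b) = D0 a \<oplus>\<^bsub>R\<^esub> D0 b"
    using a b by (simp only: R.h_eq_iff D0(1) R.a_closed)
  have "val_R (D0 (a \<otimes>\<^bsub>R\<^esub> b)) = val_R (D0 a \<otimes>\<^bsub>R\<^esub> b \<oplus>\<^bsub>R\<^esub> a \<otimes>\<^bsub>R\<^esub> D0 b)"
    using a b by (simp add: D0 R.h_simps) (simp add: \<Delta>_def pderiv_mult algebra_simps)
  then show "D0 (a \<otimes>\<^bsub>R\<^esub> b) = D0 a \<otimes>\<^bsub>R\<^esub> b \<oplus>\<^bsub>R\<^esub> a \<otimes>\<^bsub>R\<^esub> D0 b"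
    using a b by (simp only: R.h_eq_iff D0(1) R.a_closed R.m_closed)
next
  fix c
  have "val_R (D0 ((cR \<circ> const3) c)) = 0"
    by (simp add: D0 cR_closed val_cR eval3_simps \<Delta>_def pderiv_pCons)
  then show "D0 ((cR \<circ> const3) c) = \<zero>\<^bsub>R\<^esub>"
    by (simp only: R.h_eq_0_iff D0(1) cR_closed o_apply)
next
  have "val_R (D0 (cR sR)) \<noteq> 0"
    by (simp add: D0 cR_closed val_cR eval_R_s \<Delta>_def pderiv_pCons)
  then have "D0 (cR sR) \<noteq> \<zero>\<^bsub>R\<^esub>" by (metis R.h_zero)
  then show "\<exists>b\<in>carrier R. D0 b \<noteq> \<zero>\<^bsub>R\<^esub>" using cR_closed by blast
qed

lemma D0_squared: "D0 (D0 (cR T1)) = \<zero>\<^bsub>R\<^esub>" "D0 (D0 (cR sR)) = \<zero>\<^bsub>R\<^esub>"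
proof -
  have "val_R (D0 (D0 (cR T1))) = 0"
    by (simp add: D0 cR_closed val_cR eval3_simps \<Delta>_def pderiv_pCons)
  then show "D0 (D0 (cR T1)) = \<zero>\<^bsub>R\<^esub>" by (simp only: R.h_eq_0_iff D0(1) cR_closed)
  have "val_R (D0 (D0 (cR sR))) = 0"
    using pderiv_x_power_mult[of "n * m + e" 1]
    by (simp add: D0 cR_closed val_cR eval_R_s \<Delta>_def pderiv_pCons)
  then show "D0 (D0 (cR sR)) = \<zero>\<^bsub>R\<^esub>" by (simp only: R.h_eq_0_iff D0(1) cR_closed)
qed

text \<open>
  Conjugation by the isomorphism from \<open>R\<close> to its ring of values.
\<close>

lemma LND_on_image_transfer:
  assumes D: "nonzero_LND (cR \<circ> const3) R D"
  shows "LND_on_image n e d m f g (\<lambda>r. val_R (D (of_val r)))"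
proof -
  have D_closed: "D U \<in> carrier R" if "U \<in> carrier R" for U
    using D that by (auto simp: nonzero_LND_def k_derivation_def)
  have of_val_add: "of_val (r + t) = of_val r \<oplus>\<^bsub>R\<^esub> of_val t" if "r \<in> RR" "t \<in> RR" for r t
    using of_val_val[of "of_val r \<oplus>\<^bsub>R\<^esub> of_val t"] that by (simp add: R.h_add of_val)
  have of_val_mult: "of_val (r * t) = of_val r \<otimes>\<^bsub>R\<^esub> of_val t" if "r \<in> RR" "t \<in> RR" for r t
    using of_val_val[of "of_val r \<otimes>\<^bsub>R\<^esub> of_val t"] that by (simp add: R.h_mult of_val)
  show ?thesis
  proof (unfold_locales)
    show "val_R (D (of_val r)) \<in> RR" if "r \<in> RR" for r
      using that by (simp add: val_R_mem D_closed of_val)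
    show "val_R (D (of_val (r + t))) = val_R (D (of_val r)) + val_R (D (of_val t))"
      if "r \<in> RR" "t \<in> RR" for r t
    proof -
      have "D (of_val r \<oplus>\<^bsub>R\<^esub> of_val t) = D (of_val r) \<oplus>\<^bsub>R\<^esub> D (of_val t)"
        using D that of_val(1) unfolding nonzero_LND_def k_derivation_def by blast
      then show ?thesis using that by (simp add: of_val_add R.h_add D_closed of_val)
    qed
    show "val_R (D (of_val (r * t))) = val_R (D (of_val r)) * t + r * val_R (D (of_val t))"
      if "r \<in> RR" "t \<in> RR" for r t
    proof -
      have "D (of_val r \<otimes>\<^bsub>R\<^esub> of_val t) = D (of_val r) \<otimes>\<^bsub>R\<^esub> of_val t \<oplus>\<^bsub>R\<^esub> of_val r \<otimes>\<^bsub>R\<^esub> D (of_val t)"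
        using D that of_val(1) unfolding nonzero_LND_def k_derivation_def by blast
      then show ?thesis using that by (simp add: of_val_mult R.h_add R.h_mult D_closed of_val)
    qed
    show "val_R (D (of_val (constK c))) = 0" for c
    proof -
      have "of_val (constK c) = cR (const3 c)"
        using of_val_val[OF cR_closed, of "const3 c"] by (simp add: val_cR eval3_simps)
      moreover have "D (cR (const3 c)) = \<zero>\<^bsub>R\<^esub>"
        using D unfolding nonzero_LND_def k_derivation_def by simp
      ultimately show ?thesis by (simp add: R.h_zero)
    qed
    show "\<exists>N. ((\<lambda>r. val_R (D (of_val r))) ^^ N) r = 0" if r: "r \<in> RR" for r
    proof -
      obtain N where N: "(D ^^ N) (of_val r) = \<zero>\<^bsub>R\<^esub>"
        using D of_val(1)[OF r] unfolding nonzero_LND_def locally_nilpotent_def by blast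
      have "(D ^^ k) (of_val r) \<in> carrier R \<and>
          ((\<lambda>r. val_R (D (of_val r))) ^^ k) r = val_R ((D ^^ k) (of_val r))" for k
        using r by (induction k) (auto simp: of_val of_val_val D_closed)
      with N show ?thesis by (metis R.h_zero)
    qed
    show "\<exists>r\<in>RR. val_R (D (of_val r)) \<noteq> 0"
    proof -
      obtain U where "U \<in> carrier R" "D U \<noteq> \<zero>\<^bsub>R\<^esub>"
        using D unfolding nonzero_LND_def by blast
      then show ?thesis
        by (intro bexI[of _ "val_R U"]) (simp_all add: of_val_val R.h_eq_0_iff D_closed val_R_mem)
    qed
  qed
qed

lemma val_R_kernel_squared:
  assumes D: "nonzero_LND (cR \<circ> const3) R D" and U: "U \<in> carrier R" "D (D U) = \<zero>\<^bsub>R\<^esub>"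
  shows "val_R U \<in> range eval_A"
proof -
  interpret LND_on_image n e d m f g "\<lambda>r. val_R (D (of_val r))"
    by (rule LND_on_image_transfer[OF D])
  have "D U \<in> carrier R"
    using D U by (auto simp: nonzero_LND_def k_derivation_def)
  then have "degree (val_R U) \<le> 1"
    using U by (intro kernel_D_squared) (simp_all add: val_R_mem of_val_val R.h_zero)
  then show ?thesis by (rule degree_le_1_R[OF val_R_mem[OF U(1)]])
qed

lemma range_eval_A_subset: "range eval_A \<subseteq> RR"
  using RR.eval2_mem[OF RR_gens(2)] by blast

text \<open>
  The subring of elements with value in $k[x,s]$ is generated by $k$, $x$ and $s$; so it
  is the subalgebra generated by any subset of it that contains $x$ and $s$.
\<close>

lemma subalg_gen_eq:
  assumes "\<And>U. U \<in> H \<Longrightarrow> U \<in> carrier R \<and> val_R U \<in> range eval_A" and "cR T1 \<in> H" "cR sR \<in> H"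
  shows "subalg_gen (cR \<circ> const3) R H = {U \<in> carrier R. val_R U \<in> range eval_A}"
proof
  let ?G = "generate_ring R (range (cR \<circ> const3) \<union> H)"
  show "subalg_gen (cR \<circ> const3) R H \<subseteq> {U \<in> carrier R. val_R U \<in> range eval_A}"
  proof
    fix U assume "U \<in> subalg_gen (cR \<circ> const3) R H"
    then have "U \<in> ?G" by (simp add: subalg_gen_def)
    then show "U \<in> {U \<in> carrier R. val_R U \<in> range eval_A}"
    proof induction
      case one
      have "val_R \<one>\<^bsub>R\<^esub> = eval_A 1"
        by (simp add: R.h_one comm_ring_map.map_one[OF comm_ring_map_eval2])
      then show ?case by simp
    next
      case (incl U)
      have "val_R (cR (const3 c)) = eval_A (const2 c)" for c
        by (simp add: val_cR eval3_simps eval2_simps)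
      then show ?case using incl assms(1) cR_closed by auto
    qed (auto simp: R.h_simps simp flip: comm_ring_map.map_add[OF comm_ring_map_eval2]
        comm_ring_map.map_mult[OF comm_ring_map_eval2] comm_ring_map.map_uminus[OF comm_ring_map_eval2])
  qed
  have "of_val (eval_A p) \<in> ?G" for p
  proof (induction p rule: poly2_induct)
    case (const c)
    have "of_val (eval_A (const2 c)) = cR (const3 c)"
      using of_val_val[OF cR_closed, of "const3 c"] by (simp add: val_cR eval3_simps eval2_simps)
    then show ?case by (auto intro: generate_ring.incl)
  next
    case X
    have "of_val (eval_A X2) = cR T1"
      using of_val_val[OF cR_closed, of T1] by (simp add: val_cR eval3_simps eval2_simps)
    then show ?case using assms by (auto intro: generate_ring.incl)
  next
    case S
    have "of_val (eval_A S2) = cR sR"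
      using of_val_val[OF cR_closed, of sR] by (simp add: val_cR eval_R_s eval2_simps)
    then show ?case using assms by (auto intro: generate_ring.incl)
  next
    case (add p q)
    have pq: "eval_A p \<in> RR" "eval_A q \<in> RR" using range_eval_A_subset by blast+
    have "of_val (eval_A (p + q)) = of_val (eval_A p) \<oplus>\<^bsub>R\<^esub> of_val (eval_A q)"
      using of_val_val[of "of_val (eval_A p) \<oplus>\<^bsub>R\<^esub> of_val (eval_A q)"] pq
      by (simp add: R.h_simps of_val comm_ring_map.map_add[OF comm_ring_map_eval2])
    then show ?case using add by (simp add: generate_ring.eng_add)
  next
    case (mult p q)
    have pq: "eval_A p \<in> RR" "eval_A q \<in> RR" using range_eval_A_subset by blast+
    have "of_val (eval_A (p * q)) = of_val (eval_A p) \<otimes>\<^bsub>R\<^esub> of_val (eval_A q)"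
      using of_val_val[of "of_val (eval_A p) \<otimes>\<^bsub>R\<^esub> of_val (eval_A q)"] pq
      by (simp add: R.h_simps of_val comm_ring_map.map_mult[OF comm_ring_map_eval2])
    then show ?case using mult by (simp add: generate_ring.eng_mult)
  qed
  then show "{U \<in> carrier R. val_R U \<in> range eval_A} \<subseteq> subalg_gen (cR \<circ> const3) R H"
    unfolding subalg_gen_def using of_val_val by force
qed

lemma AL_R: "AL_invariant (cR \<circ> const3) R = {U \<in> carrier R. val_R U \<in> range eval_A}"
  unfolding AL_invariant_def
proof (rule subalg_gen_eq)
  fix U assume "U \<in> (\<Union>D\<in>{D. nonzero_LND (cR \<circ> const3) R D}. {b \<in> carrier R. D (D b) = \<zero>\<^bsub>R\<^esub>})"
  then show "U \<in> carrier R \<and> val_R U \<in> range eval_A" using val_R_kernel_squared by blast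
qed (use nonzero_LND_D0 D0_squared cR_closed in blast)+

lemma subalg_gen_x_s: "subalg_gen (cR \<circ> const3) R {cR T1, cR sR} = {U \<in> carrier R. val_R U \<in> range eval_A}"
proof (rule subalg_gen_eq)
  have "val_R (cR T1) = eval_A X2" "val_R (cR sR) = eval_A S2"
    by (simp_all add: val_cR eval3_simps eval2_simps eval_R_s)
  then show "U \<in> carrier R \<and> val_R U \<in> range eval_A" if "U \<in> {cR T1, cR sR}" for U
    using that cR_closed by auto
qed auto


section \<open>The three affine modifications\<close>

interpretation B: embedded_ring B val_B by (rule embedded_B)
interpretation A: embedded_ring poly2_ring eval_A by (rule embedded_eval2_s)

lemma eval_A_P_poly: "eval_A (P_poly d f) = PK"
  by (simp add: P_poly_def PK_def comm_ring_map.map_monic_at[OF comm_ring_map_eval2]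
      eval2_inX2 eval2_simps)

text \<open>
  Replacing $P(x,s)$ by $x^n y$ makes $x^{nm}$ a factor of each summand of $F$, and the cofactor is
  $Q(x,y) - s = x^e z$.
\<close>

lemma eval_A_F_poly: "eval_A (F_poly n d m f g) = xK ^ (n * m + e) * zK"
proof -
  have "eval_A (F_poly n d m f g) =
      PK ^ m + (\<Sum>j<m. xK ^ (n * (m - j)) * of_X (g j) * PK ^ j) - xK ^ (n * m) * sK"
    unfolding F_poly_def
    by (simp only: comm_ring_map.map_simps[OF comm_ring_map_eval2] eval_A_P_poly eval2_inX2 eval2_simps)
  also have "PK ^ m = xK ^ (n * m) * yK ^ m"
    by (simp only: x_y[symmetric] power_mult_distrib power_mult)
  also have "(\<Sum>j<m. xK ^ (n * (m - j)) * of_X (g j) * PK ^ j) =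
      (\<Sum>j<m. xK ^ (n * m) * (of_X (g j) * yK ^ j))"
  proof (rule sum.cong[OF refl])
    fix j assume "j \<in> {..<m}"
    then have "n * m = n * (m - j) + n * j" by (simp flip: distrib_left)
    then have "xK ^ (n * m) = (xK ^ (n * (m - j)) * (xK ^ n) ^ j :: 'k fls poly)"
      by (simp only: power_add power_mult)
    then show "xK ^ (n * (m - j)) * of_X (g j) * PK ^ j = xK ^ (n * m) * (of_X (g j) * yK ^ j)"
      by (simp only: x_y[symmetric] power_mult_distrib mult_ac)
  qed
  also have "xK ^ (n * m) * yK ^ m + (\<Sum>j<m. xK ^ (n * m) * (of_X (g j) * yK ^ j)) - xK ^ (n * m) * sK
      = xK ^ (n * m) * (QK - sK)"
    by (simp only: QK_def monic_at_def distrib_left right_diff_distrib sum_distrib_left)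
  also have "\<dots> = xK ^ (n * m + e) * zK"
    by (simp only: x_z[symmetric] power_add mult_ac)
  finally show ?thesis .
qed

lemma xK_power_nonzero: "xK ^ k \<noteq> (0 :: 'k fls poly)"
  by simp

lemma R_affine_modification_of_A:
  "\<exists>\<phi>. alg_hom const2 poly2_ring (cR \<circ> const3) R \<phi> \<and> \<phi> X2 = cR T1 \<and> \<phi> S2 = cR sR \<and>
    \<phi> \<in> ring_iso poly2_ring (R\<lparr>carrier := AL_invariant (cR \<circ> const3) R\<rparr>) \<and>
    is_affine_modification \<phi> R poly2_ring (X2 ^ (n * m + e)) (I1 n e d m f g)"
proof -
  obtain \<phi> where hom: "\<phi> \<in> ring_hom poly2_ring R"
    and \<phi>: "\<And>p. p \<in> carrier poly2_ring \<Longrightarrow> val_R (\<phi> p) = eval_A p"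
    using subalgebra_transfer[OF embedded_eval2_s embedded_R] range_eval_A_subset
    unfolding val_R_image by auto
  have closed: "\<phi> p \<in> carrier R" for p using ring_hom_closed[OF hom, of p] by simp
  have eqI: "\<phi> p = cR r" if "eval_A p = eval_R r" for p r
    using that \<phi>[of p] R.h_eq_iff[OF closed cR_closed, of p r] by (simp add: val_cR)
  have "alg_hom const2 poly2_ring (cR \<circ> const3) R \<phi>"
    unfolding alg_hom_def using hom by (auto intro!: eqI simp: eval2_simps eval3_simps)
  moreover have "\<phi> X2 = cR T1" "\<phi> S2 = cR sR"
    by (auto intro!: eqI simp: eval2_simps eval3_simps eval_R_s)
  moreover have "\<phi> \<in> ring_iso poly2_ring (R\<lparr>carrier := AL_invariant (cR \<circ> const3) R\<rparr>)"
    unfolding AL_R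
  proof (rule ring_iso_memI)
    have "inj \<phi>"
    proof (rule injI)
      fix p q assume "\<phi> p = \<phi> q"
      then have "eval_A p = eval_A q" using \<phi>[of p] \<phi>[of q] by simp
      then show "p = q" using A.h_eq_iff[of p q] by simp
    qed
    moreover have "range \<phi> = {U \<in> carrier R. val_R U \<in> range eval_A}"
    proof
      show "{U \<in> carrier R. val_R U \<in> range eval_A} \<subseteq> range \<phi>"
      proof safe
        fix U p assume U: "U \<in> carrier R" "val_R U = eval_A p"
        then have "U = \<phi> p" using \<phi>[of p] R.h_eq_iff[OF U(1) closed, of p] by simp
        then show "U \<in> range \<phi>" by simp
      qed
    qed (use \<phi> closed in auto)
    ultimately show "bij_betw \<phi> (carrier poly2_ring)
        (carrier (R\<lparr>carrier := {U \<in> carrier R. val_R U \<in> range eval_A}\<rparr>))"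
      by (simp add: bij_betw_def)
  qed (use \<phi> closed ring_hom_mult[OF hom] ring_hom_add[OF hom] ring_hom_one[OF hom] in simp_all)
  moreover have "is_affine_modification \<phi> R poly2_ring (X2 ^ (n * m + e)) (I1 n e d m f g)"
    unfolding I1_def
  proof (rule is_affine_modificationI[OF embedded_eval2_s embedded_R _ _ _ hom \<phi>])
    have f: "eval_A (X2 ^ (n * m + e)) = xK ^ (n * m + e)"
      by (simp only: comm_ring_map.map_power[OF comm_ring_map_eval2] eval2_simps)
    show "(X2 :: 'k poly2) ^ (n * m + e) \<noteq> \<zero>\<^bsub>poly2_ring\<^esub>"
      using A.h_zero f xK_power_nonzero by metis
    have "n * m + e = n * (m - 1) + e + n" using m by (cases m) auto
    then have y: "eval_A (X2 ^ (n * (m - 1) + e) * P_poly d f) = xK ^ (n * m + e) * yK"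
      by (simp only: comm_ring_map.map_simps[OF comm_ring_map_eval2] eval2_simps eval_A_P_poly
          x_y[symmetric] power_add mult_ac)
    show "\<exists>r\<in>carrier R. eval_A (X2 ^ (n * m + e)) * val_R r = eval_A a"
      if "a \<in> {X2 ^ (n * m + e), X2 ^ (n * (m - 1) + e) * P_poly d f, F_poly n d m f g}" for a
    proof -
      have "xK ^ (n * m + e) * 1 = eval_A a \<or> xK ^ (n * m + e) * yK = eval_A a \<or>
          xK ^ (n * m + e) * zK = eval_A a"
        using that f y eval_A_F_poly by auto
      then have "\<exists>t\<in>RR. xK ^ (n * m + e) * t = eval_A a"
        using RR_gens RR.one_mem by blast
      then show ?thesis unfolding f val_R_image[symmetric] by blast
    qed
    fix T r
    assume T: "\<And>a. a \<in> carrier poly2_ring \<Longrightarrow> eval_A a \<in> T"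
      "\<And>a t. a \<in> {X2 ^ (n * m + e), X2 ^ (n * (m - 1) + e) * P_poly d f, F_poly n d m f g} \<Longrightarrow>
         eval_A (X2 ^ (n * m + e)) * t = eval_A a \<Longrightarrow> t \<in> T"
      "\<And>t t'. t \<in> T \<Longrightarrow> t' \<in> T \<Longrightarrow> t + t' \<in> T" "\<And>t t'. t \<in> T \<Longrightarrow> t' \<in> T \<Longrightarrow> t * t' \<in> T"
      and r: "r \<in> carrier R"
    have "K_subalgebra T"
      using T(1)[of "const2 _"] T(1)[of X2] T(3,4) by unfold_locales (auto simp: eval2_simps)
    moreover have "yK \<in> T" "zK \<in> T"
      using T(2)[of "X2 ^ (n * (m - 1) + e) * P_poly d f" yK] T(2)[of "F_poly n d m f g" zK]
        f y eval_A_F_poly by simp_all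
    ultimately show "val_R r \<in> T"
      using K_subalgebra.eval3_mem[of T yK zK] val_R_mem[OF r] by auto
  qed auto
  ultimately show ?thesis by blast
qed

lemma B_affine_modification_of_A:
  "\<exists>\<phi>. alg_hom const2 poly2_ring (cB \<circ> const3) B \<phi> \<and> \<phi> X2 = cB T1 \<and> \<phi> S2 = cB T2 \<and>
    is_affine_modification \<phi> B poly2_ring (X2 ^ n) (I2 n d f)"
proof -
  interpret BB: K_subalgebra "range eval_B" by (rule K_subalgebra_range_eval3)
  have gens: "sK \<in> range eval_B" "yK \<in> range eval_B"
    using eval3_simps(3,4)[of sK yK] by (metis rangeI)+
  have "range eval_A \<subseteq> range eval_B" using BB.eval2_mem[OF gens(1)] by blast
  then obtain \<phi> where hom: "\<phi> \<in> ring_hom poly2_ring B"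
    and \<phi>: "\<And>p. p \<in> carrier poly2_ring \<Longrightarrow> val_B (\<phi> p) = eval_A p"
    using subalgebra_transfer[OF embedded_eval2_s embedded_B]
    unfolding val_B_image by auto
  have closed: "\<phi> p \<in> carrier B" for p using ring_hom_closed[OF hom, of p] by simp
  have eqI: "\<phi> p = cB r" if "eval_A p = eval_B r" for p r
    using that \<phi>[of p] B.h_eq_iff[OF closed cB_closed, of p r] by (simp add: val_cB)
  have "alg_hom const2 poly2_ring (cB \<circ> const3) B \<phi>"
    unfolding alg_hom_def using hom by (auto intro!: eqI simp: eval2_simps eval3_simps)
  moreover have "\<phi> X2 = cB T1" "\<phi> S2 = cB T2"
    by (auto intro!: eqI simp: eval2_simps eval3_simps)
  moreover have "is_affine_modification \<phi> B poly2_ring (X2 ^ n) (I2 n d f)"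
    unfolding I2_def
  proof (rule is_affine_modificationI[OF embedded_eval2_s embedded_B _ _ _ hom \<phi>])
    have f: "eval_A (X2 ^ n) = xK ^ n"
      by (simp only: comm_ring_map.map_power[OF comm_ring_map_eval2] eval2_simps)
    show "(X2 :: 'k poly2) ^ n \<noteq> \<zero>\<^bsub>poly2_ring\<^esub>"
      using A.h_zero f xK_power_nonzero by metis
    show "\<exists>r\<in>carrier B. eval_A (X2 ^ n) * val_B r = eval_A a" if "a \<in> {X2 ^ n, P_poly d f}" for a
    proof -
      have "xK ^ n * 1 = eval_A a \<or> xK ^ n * yK = eval_A a"
        using that f x_y eval_A_P_poly by auto
      then have "\<exists>t\<in>range eval_B. xK ^ n * t = eval_A a"
        using gens BB.one_mem by blast
      then show ?thesis unfolding f val_B_image[symmetric] by blast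
    qed
    fix T r
    assume T: "\<And>a. a \<in> carrier poly2_ring \<Longrightarrow> eval_A a \<in> T"
      "\<And>a t. a \<in> {X2 ^ n, P_poly d f} \<Longrightarrow> eval_A (X2 ^ n) * t = eval_A a \<Longrightarrow> t \<in> T"
      "\<And>t t'. t \<in> T \<Longrightarrow> t' \<in> T \<Longrightarrow> t + t' \<in> T" "\<And>t t'. t \<in> T \<Longrightarrow> t' \<in> T \<Longrightarrow> t * t' \<in> T"
      and r: "r \<in> carrier B"
    have "K_subalgebra T"
      using T(1)[of "const2 _"] T(1)[of X2] T(3,4) by unfold_locales (auto simp: eval2_simps)
    moreover have "sK \<in> T" using T(1)[of S2] by (simp add: eval2_simps)
    moreover have "yK \<in> T" using T(2)[of "P_poly d f" yK] f x_y eval_A_P_poly by simp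
    moreover have "val_B r \<in> range eval_B" using r val_B_image by blast
    ultimately show "val_B r \<in> T"
      using K_subalgebra.eval3_mem[of T sK yK] by auto
  qed auto
  ultimately show ?thesis by blast
qed

lemma R_affine_modification_of_B:
  "\<exists>\<phi>. alg_hom (cB \<circ> const3) B (cR \<circ> const3) R \<phi> \<and>
    \<phi> (cB T1) = cR T1 \<and> \<phi> (cB T2) = cR sR \<and> \<phi> (cB T3) = cR T2 \<and>
    is_affine_modification \<phi> R B (cB (T1 ^ e)) (I3 n e d m f g)"
proof -
  have sub: "range eval_B \<subseteq> RR" using RR.eval3_mem[OF RR_gens(2,3)] by blast
  obtain \<phi> where hom: "\<phi> \<in> ring_hom B R"
    and \<phi>: "\<And>U. U \<in> carrier B \<Longrightarrow> val_R (\<phi> U) = val_B U"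
    using subalgebra_transfer[OF embedded_B embedded_R] sub
    unfolding val_R_image val_B_image by blast
  have closed: "\<phi> U \<in> carrier R" if "U \<in> carrier B" for U using ring_hom_closed[OF hom that] .
  have eqI: "\<phi> (cB p) = cR r" if "eval_B p = eval_R r" for p r
    using that \<phi>[OF cB_closed, of p] R.h_eq_iff[OF closed[OF cB_closed] cR_closed, of p r]
    by (simp add: val_cR val_cB)
  have "alg_hom (cB \<circ> const3) B (cR \<circ> const3) R \<phi>"
    unfolding alg_hom_def using hom by (auto intro!: eqI simp: eval3_simps)
  moreover have "\<phi> (cB T1) = cR T1" "\<phi> (cB T2) = cR sR" "\<phi> (cB T3) = cR T2"
    by (auto intro!: eqI simp: eval3_simps eval_R_s)
  moreover have "is_affine_modification \<phi> R B (cB (T1 ^ e)) (I3 n e d m f g)"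
    unfolding I3_def
  proof (rule is_affine_modificationI[OF embedded_B embedded_R _ _ _ hom \<phi>])
    have f: "val_B (cB (T1 ^ e)) = xK ^ e"
      by (simp only: val_cB comm_ring_map.map_power[OF comm_ring_map_eval3] eval3_simps)
    have z: "val_B (cB (monic_at inX3 g m T3 - T2)) = xK ^ e * zK"
      by (simp only: val_cB comm_ring_map.map_simps[OF comm_ring_map_eval3] eval3_simps
          eval3_inX3 x_z QK_def)
    show "cB (T1 ^ e) \<noteq> \<zero>\<^bsub>B\<^esub>"
      using B.h_zero f xK_power_nonzero by metis
    show "{cB (T1 ^ e), cB (monic_at inX3 g m T3 - T2)} \<subseteq> carrier B"
      using cB_closed by simp
    show "\<exists>r\<in>carrier R. val_B (cB (T1 ^ e)) * val_R r = val_B a"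
      if "a \<in> {cB (T1 ^ e), cB (monic_at inX3 g m T3 - T2)}" for a
    proof -
      have "xK ^ e * 1 = val_B a \<or> xK ^ e * zK = val_B a"
        using that f z by auto
      then have "\<exists>t\<in>RR. xK ^ e * t = val_B a"
        using RR_gens RR.one_mem by blast
      then show ?thesis unfolding f val_R_image[symmetric] by blast
    qed
    fix T r
    assume T: "\<And>a. a \<in> carrier B \<Longrightarrow> val_B a \<in> T"
      "\<And>a t. a \<in> {cB (T1 ^ e), cB (monic_at inX3 g m T3 - T2)} \<Longrightarrow>
         val_B (cB (T1 ^ e)) * t = val_B a \<Longrightarrow> t \<in> T"
      "\<And>t t'. t \<in> T \<Longrightarrow> t' \<in> T \<Longrightarrow> t + t' \<in> T" "\<And>t t'. t \<in> T \<Longrightarrow> t' \<in> T \<Longrightarrow> t * t' \<in> T"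
      and r: "r \<in> carrier R"
    have B_T: "eval_B p \<in> T" for p using T(1)[OF cB_closed, of p] by (simp add: val_cB)
    have "K_subalgebra T"
      using B_T[of "const3 _"] B_T[of T1] T(3,4) by unfold_locales (auto simp: eval3_simps)
    moreover have "yK \<in> T" using B_T[of T3] by (simp add: eval3_simps)
    moreover have "zK \<in> T" using T(2)[of "cB (monic_at inX3 g m T3 - T2)" zK] f z by simp
    ultimately show "val_R r \<in> T"
      using K_subalgebra.eval3_mem[of T yK zK] val_R_mem[OF r] by auto
  qed auto
  ultimately show ?thesis by blast
qed

end

theorem proposition4p2:
  fixes n e d m :: nat and f g :: "nat \<Rightarrow> ('k::field_char_0) poly"
  assumes "n \<ge> 1" and "(n, e) \<noteq> (1, 0)" and "d \<ge> 2" and "m \<ge> 2"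
  defines "R \<equiv> R_alg n e d m f g" and "B \<equiv> B_alg n d f"
    and "cR \<equiv> R_class n e d m f g" and "cB \<equiv> B_class n d f"
  defines "x \<equiv> cR T1" and "y \<equiv> cR T2" and "s \<equiv> cR (sR_poly e m g)"
    and "AL \<equiv> AL_invariant (cR \<circ> const3) R"
  shows
    "AL = subalg_gen (cR \<circ> const3) R {x, s} \<and>
     (\<exists>\<phi>. alg_hom const2 poly2_ring (cR \<circ> const3) R \<phi> \<and> \<phi> X2 = x \<and> \<phi> S2 = s \<and>
          \<phi> \<in> ring_iso poly2_ring (R\<lparr>carrier := AL\<rparr>) \<and>
          is_affine_modification \<phi> R poly2_ring (X2 ^ (n * m + e)) (I1 n e d m f g)) \<and>
     (\<exists>\<phi>. alg_hom const2 poly2_ring (cB \<circ> const3) B \<phi> \<and> \<phi> X2 = cB T1 \<and> \<phi> S2 = cB T2 \<and>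
          is_affine_modification \<phi> B poly2_ring (X2 ^ n) (I2 n d f)) \<and>
     (\<exists>\<phi>. alg_hom (cB \<circ> const3) B (cR \<circ> const3) R \<phi> \<and>
          \<phi> (cB T1) = x \<and> \<phi> (cB T2) = s \<and> \<phi> (cB T3) = y \<and>
          is_affine_modification \<phi> R B (cB (T1 ^ e)) (I3 n e d m f g))"
proof -
  interpret double_danielewski n e d m f g
    using assms(1-4) by (rule double_danielewski.intro)
  show ?thesis
    unfolding R_def B_def cR_def cB_def x_def y_def s_def AL_def
    using AL_R[folded subalg_gen_x_s] R_affine_modification_of_A B_affine_modification_of_A
      R_affine_modification_of_B by (intro conjI)
qed

end
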